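(* Let $G$ be a unimodular Lie group with a left-invariant pseudo-Riemannian metric $\langle\cdot,\cdot\rangle$, and let $\mathfrak{g}$ be the (unimodular) Lie algebra of left-invariant vector fields on $G$. If $X\in\mathfrak{g}$ is a vector field satisfying $$(R-\lambda)\langle\cdot,\cdot\rangle=\tfrac12\mathfrak{L}_X\langle\cdot,\cdot\rangle$$ for some constant $\lambda\in\mathbb{R}$, where $R$ is the scalar curvature of $\langle\cdot,\cdot\rangle$, then $X$ is a Killing vector field. That is, left-invariant Yamabe solitons on unimodular Lie groups are trivial.
   Context: A Lie group $G$ with Lie algebra $\mathfrak{g}$ of left-invariant vector fields is called unimodular if $\mathrm{tr}(\mathrm{ad}_X)=0$ for every $X\in\mathfrak{g}$, where $\mathrm{ad}_X(Y)=[X,Y]$. A metric on $G$ is left-invariant if all left translations are isometries. $\mathfrak{L}_X$ is the Lie derivative, $(\mathfrak{L}_X\langle\cdot,\cdot\rangle)(Y,Z)=X\langle Y,Z\rangle-\langle[X,Y],Z\rangle-\langle Y,[X,Z]\rangle$, and $X$ is Killing if $\mathfrak{L}_X\langle\cdot,\cdot\rangle=0$. A Yamabe soliton is a complete manifold with a metric $\langle\cdot,\cdot\rangle$, a vector field $X$ (the soliton vector field) and a constant $\lambda$ satisfying the displayed equation; it is left-invariant if the metric and $X$ are left-invariant, and it is trivial if its soliton vector field is Killing. *)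

theory Defs
  imports "HOL-Analysis.Analysis" "HOL-Library.Function_Algebras"
begin

section \<open>Functions as a real vector space, and traces\<close>

text \<open>Tangent vectors and vector fields below are real-valued functions, so the pointwise
  structure makes the vocabulary of real vector spaces available for them.\<close>

instantiation "fun" :: (type, real_vector) real_vector
begin

definition scaleR_fun :: "real \<Rightarrow> ('a \<Rightarrow> 'b) \<Rightarrow> 'a \<Rightarrow> 'b"
  where "scaleR_fun c f = (\<lambda>x. c *\<^sub>R f x)"

instance
  by standard (auto simp: scaleR_fun_def plus_fun_def fun_eq_iff scaleR_add_right scaleR_add_left)

end

text \<open>Trace of an endomorphism \<open>T\<close> of a finite-dimensional subspace \<open>V\<close>, as the sum of the
  diagonal matrix entries in some (equivalently, any) basis of \<open>V\<close>.\<close>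

definition trace_on :: "'v::real_vector set \<Rightarrow> ('v \<Rightarrow> 'v) \<Rightarrow> real"
  where "trace_on V T =
    (let B = (SOME B. independent B \<and> span B = V) in \<Sum>b\<in>B. representation B (T b) b)"


section \<open>Smooth manifolds\<close>

text \<open>\<open>C\<^sup>k\<close> and \<open>C\<^sup>\<infinity>\<close> maps; only meant for open \<open>S\<close>.\<close>

primrec Ck_on :: "nat \<Rightarrow> 'e::real_normed_vector set \<Rightarrow> ('e \<Rightarrow> 'f::real_normed_vector) \<Rightarrow> bool"
  where
    "Ck_on 0 S f \<longleftrightarrow> continuous_on S f"
  | "Ck_on (Suc k) S f \<longleftrightarrow>
       (\<forall>x\<in>S. f differentiable (at x)) \<and> (\<forall>v. Ck_on k S (\<lambda>x. frechet_derivative f (at x) v))"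

definition smooth_on :: "'e::real_normed_vector set \<Rightarrow> ('e \<Rightarrow> 'f::real_normed_vector) \<Rightarrow> bool"
  where "smooth_on S f \<longleftrightarrow> (\<forall>k. Ck_on k S f)"

text \<open>A chart is a pair of its domain and its coordinate map; the values of the coordinate map
  outside the domain are irrelevant.\<close>

type_synonym ('a, 'e) chart = "'a set \<times> ('a \<Rightarrow> 'e)"

definition is_chart :: "('a::topological_space, 'e::euclidean_space) chart \<Rightarrow> bool"
  where "is_chart c \<longleftrightarrow> (case c of (U, \<phi>) \<Rightarrow>
    open U \<and> open (\<phi> ` U) \<and> homeomorphism U (\<phi> ` U) \<phi> (inv_into U \<phi>))"

text \<open>The manifold is the whole type; being Hausdorff and second countable is part of the type
  constraint. The atlas need not be maximal.\<close>

definition smooth_atlas ::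
    "('a::{t2_space,second_countable_topology}, 'e::euclidean_space) chart set \<Rightarrow> bool"
  where "smooth_atlas A \<longleftrightarrow>
    (\<forall>c\<in>A. is_chart c) \<and> (\<Union>(U, \<phi>)\<in>A. U) = UNIV \<and>
    (\<forall>(U, \<phi>)\<in>A. \<forall>(V, \<psi>)\<in>A. smooth_on (\<phi> ` (U \<inter> V)) (\<psi> \<circ> inv_into U \<phi>))"

definition smooth_map :: "('a::topological_space, 'e::euclidean_space) chart set \<Rightarrow>
    ('b::topological_space, 'f::euclidean_space) chart set \<Rightarrow> ('a \<Rightarrow> 'b) \<Rightarrow> bool"
  where "smooth_map A B F \<longleftrightarrow> continuous_on UNIV F \<and>
    (\<forall>(U, \<phi>)\<in>A. \<forall>(V, \<psi>)\<in>B. smooth_on (\<phi> ` (U \<inter> F -` V)) (\<psi> \<circ> F \<circ> inv_into U \<phi>))"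

definition product_atlas ::
    "('a, 'e) chart set \<Rightarrow> ('b, 'f) chart set \<Rightarrow> ('a \<times> 'b, 'e \<times> 'f) chart set"
  where "product_atlas A B = {(U \<times> V, map_prod \<phi> \<psi>) | U \<phi> V \<psi>. (U, \<phi>) \<in> A \<and> (V, \<psi>) \<in> B}"

definition smooth_functions :: "('a::topological_space, 'e::euclidean_space) chart set \<Rightarrow> ('a \<Rightarrow> real) set"
  where "smooth_functions A = {f. \<forall>(U, \<phi>)\<in>A. smooth_on (\<phi> ` U) (f \<circ> inv_into U \<phi>)}"


section \<open>Tangent vectors and vector fields\<close>

text \<open>Tangent vectors are point derivations of the algebra of smooth functions. They are
  extended by \<open>0\<close> to non-smooth functions, so that equality of tangent vectors is equality of
  HOL functions.\<close>

type_synonym 'a tvec = "('a \<Rightarrow> real) \<Rightarrow> real"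
type_synonym 'a vfield = "'a \<Rightarrow> 'a tvec"

definition tangent_space ::
    "('a::topological_space, 'e::euclidean_space) chart set \<Rightarrow> 'a \<Rightarrow> 'a tvec set"
  where "tangent_space A p = {v.
    (\<forall>f\<in>smooth_functions A. \<forall>h\<in>smooth_functions A. v (\<lambda>x. f x + h x) = v f + v h) \<and>
    (\<forall>c. \<forall>f\<in>smooth_functions A. v (\<lambda>x. c * f x) = c * v f) \<and>
    (\<forall>f\<in>smooth_functions A. \<forall>h\<in>smooth_functions A. v (\<lambda>x. f x * h x) = f p * v h + h p * v f) \<and>
    (\<forall>f. f \<notin> smooth_functions A \<longrightarrow> v f = 0)}"

definition differential ::
    "('b::topological_space, 'f::euclidean_space) chart set \<Rightarrow> ('a \<Rightarrow> 'b) \<Rightarrow> 'a tvec \<Rightarrow> 'b tvec"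
  where "differential B F v = (\<lambda>f. if f \<in> smooth_functions B then v (f \<circ> F) else 0)"

definition vector_fields ::
    "('a::topological_space, 'e::euclidean_space) chart set \<Rightarrow> 'a vfield set"
  where "vector_fields A = {X. (\<forall>p. X p \<in> tangent_space A p) \<and>
    (\<forall>f\<in>smooth_functions A. (\<lambda>p. X p f) \<in> smooth_functions A)}"

text \<open>On non-smooth functions the bracket of two vector fields is automatically \<open>0\<close>.\<close>

definition lie_bracket :: "'a vfield \<Rightarrow> 'a vfield \<Rightarrow> 'a vfield"
  where "lie_bracket X Y = (\<lambda>p f. X p (\<lambda>q. Y q f) - Y p (\<lambda>q. X q f))"

definition fun_scale :: "('a \<Rightarrow> real) \<Rightarrow> 'a vfield \<Rightarrow> 'a vfield"
  where "fun_scale f X = (\<lambda>p. f p *\<^sub>R X p)"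


section \<open>Pseudo-Riemannian metrics and scalar curvature\<close>

type_synonym 'a mtensor = "'a \<Rightarrow> 'a tvec \<Rightarrow> 'a tvec \<Rightarrow> real"

definition metric_fun :: "'a mtensor \<Rightarrow> 'a vfield \<Rightarrow> 'a vfield \<Rightarrow> 'a \<Rightarrow> real"
  where "metric_fun g Y Z = (\<lambda>p. g p (Y p) (Z p))"

text \<open>No signature is prescribed. Constancy of the index is not imposed separately: it is
  automatic on connected manifolds and for left-invariant metrics on Lie groups.\<close>

definition pseudo_riemannian_metric ::
    "('a::topological_space, 'e::euclidean_space) chart set \<Rightarrow> 'a mtensor \<Rightarrow> bool"
  where "pseudo_riemannian_metric A g \<longleftrightarrow>
    (\<forall>p. \<forall>u\<in>tangent_space A p. \<forall>v\<in>tangent_space A p. g p u v = g p v u) \<and>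
    (\<forall>p. \<forall>u\<in>tangent_space A p. \<forall>v\<in>tangent_space A p. \<forall>w\<in>tangent_space A p.
       g p (u + v) w = g p u w + g p v w) \<and>
    (\<forall>p c. \<forall>u\<in>tangent_space A p. \<forall>w\<in>tangent_space A p. g p (c *\<^sub>R u) w = c * g p u w) \<and>
    (\<forall>p. \<forall>u\<in>tangent_space A p. (\<forall>v\<in>tangent_space A p. g p u v = 0) \<longrightarrow> u = 0) \<and>
    (\<forall>Y\<in>vector_fields A. \<forall>Z\<in>vector_fields A. metric_fun g Y Z \<in> smooth_functions A)"

definition affine_connection ::
    "('a::topological_space, 'e::euclidean_space) chart set \<Rightarrow>
     ('a vfield \<Rightarrow> 'a vfield \<Rightarrow> 'a vfield) \<Rightarrow> bool"
  where "affine_connection A D \<longleftrightarrow>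
    (\<forall>X\<in>vector_fields A. \<forall>Y\<in>vector_fields A. D X Y \<in> vector_fields A) \<and>
    (\<forall>X\<in>vector_fields A. \<forall>X'\<in>vector_fields A. \<forall>Y\<in>vector_fields A.
       D (X + X') Y = D X Y + D X' Y) \<and>
    (\<forall>f\<in>smooth_functions A. \<forall>X\<in>vector_fields A. \<forall>Y\<in>vector_fields A.
       D (fun_scale f X) Y = fun_scale f (D X Y)) \<and>
    (\<forall>X\<in>vector_fields A. \<forall>Y\<in>vector_fields A. \<forall>Y'\<in>vector_fields A.
       D X (Y + Y') = D X Y + D X Y') \<and>
    (\<forall>f\<in>smooth_functions A. \<forall>X\<in>vector_fields A. \<forall>Y\<in>vector_fields A.
       D X (fun_scale f Y) = fun_scale (\<lambda>p. X p f) Y + fun_scale f (D X Y))"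

definition is_levi_civita ::
    "('a::topological_space, 'e::euclidean_space) chart set \<Rightarrow> 'a mtensor \<Rightarrow>
     ('a vfield \<Rightarrow> 'a vfield \<Rightarrow> 'a vfield) \<Rightarrow> bool"
  where "is_levi_civita A g D \<longleftrightarrow> affine_connection A D \<and>
    (\<forall>X\<in>vector_fields A. \<forall>Y\<in>vector_fields A. D X Y - D Y X = lie_bracket X Y) \<and>
    (\<forall>X\<in>vector_fields A. \<forall>Y\<in>vector_fields A. \<forall>Z\<in>vector_fields A. \<forall>p.
       X p (metric_fun g Y Z) = metric_fun g (D X Y) Z p + metric_fun g Y (D X Z) p)"

text \<open>The connection is unique only on vector fields; the choice operator also fixes its
  irrelevant values on other arguments.\<close>

definition levi_civita ::
    "('a::topological_space, 'e::euclidean_space) chart set \<Rightarrow> 'a mtensor \<Rightarrow>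
     'a vfield \<Rightarrow> 'a vfield \<Rightarrow> 'a vfield"
  where "levi_civita A g = (SOME D. is_levi_civita A g D)"

definition curvature ::
    "('a vfield \<Rightarrow> 'a vfield \<Rightarrow> 'a vfield) \<Rightarrow> 'a vfield \<Rightarrow> 'a vfield \<Rightarrow> 'a vfield \<Rightarrow> 'a vfield"
  where "curvature D X Y Z = D X (D Y Z) - D Y (D X Z) - D (lie_bracket X Y) Z"

text \<open>The curvature is tensorial, so its value on tangent vectors at \<open>p\<close> is computed with
  arbitrary vector fields extending them.\<close>

definition extend_vector ::
    "('a::topological_space, 'e::euclidean_space) chart set \<Rightarrow> 'a \<Rightarrow> 'a tvec \<Rightarrow> 'a vfield"
  where "extend_vector A p u = (SOME U. U \<in> vector_fields A \<and> U p = u)"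

definition ricci ::
    "('a::topological_space, 'e::euclidean_space) chart set \<Rightarrow> 'a mtensor \<Rightarrow> 'a mtensor"
  where "ricci A g p v w = trace_on (tangent_space A p)
    (\<lambda>u. curvature (levi_civita A g)
            (extend_vector A p u) (extend_vector A p v) (extend_vector A p w) p)"

definition ricci_operator ::
    "('a::topological_space, 'e::euclidean_space) chart set \<Rightarrow> 'a mtensor \<Rightarrow> 'a \<Rightarrow> 'a tvec \<Rightarrow> 'a tvec"
  where "ricci_operator A g p v =
    (THE w. w \<in> tangent_space A p \<and> (\<forall>z\<in>tangent_space A p. g p w z = ricci A g p v z))"

definition scalar_curvature ::
    "('a::topological_space, 'e::euclidean_space) chart set \<Rightarrow> 'a mtensor \<Rightarrow> 'a \<Rightarrow> real"
  where "scalar_curvature A g p = trace_on (tangent_space A p) (ricci_operator A g p)"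

definition lie_derivative_metric ::
    "'a vfield \<Rightarrow> 'a mtensor \<Rightarrow> 'a vfield \<Rightarrow> 'a vfield \<Rightarrow> 'a \<Rightarrow> real"
  where "lie_derivative_metric X g Y Z p =
    X p (metric_fun g Y Z) - metric_fun g (lie_bracket X Y) Z p - metric_fun g Y (lie_bracket X Z) p"

definition killing_field ::
    "('a::topological_space, 'e::euclidean_space) chart set \<Rightarrow> 'a mtensor \<Rightarrow> 'a vfield \<Rightarrow> bool"
  where "killing_field A g X \<longleftrightarrow> X \<in> vector_fields A \<and>
    (\<forall>Y\<in>vector_fields A. \<forall>Z\<in>vector_fields A. \<forall>p. lie_derivative_metric X g Y Z p = 0)"


section \<open>Lie groups\<close>

definition lie_group ::
    "('a::{t2_space,second_countable_topology}, 'e::euclidean_space) chart set \<Rightarrow>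
     ('a \<Rightarrow> 'a \<Rightarrow> 'a) \<Rightarrow> 'a \<Rightarrow> ('a \<Rightarrow> 'a) \<Rightarrow> bool"
  where "lie_group A mul e inve \<longleftrightarrow> smooth_atlas A \<and> group mul e inve \<and>
    smooth_map (product_atlas A A) A (\<lambda>(x, y). mul x y) \<and> smooth_map A A inve"

definition left_invariant_fields ::
    "('a::topological_space, 'e::euclidean_space) chart set \<Rightarrow> ('a \<Rightarrow> 'a \<Rightarrow> 'a) \<Rightarrow> 'a vfield set"
  where "left_invariant_fields A mul =
    {X \<in> vector_fields A. \<forall>a p. differential A (mul a) (X p) = X (mul a p)}"

text \<open>Left translations of a Lie group are diffeomorphisms, so being isometries only means that
  they preserve the metric.\<close>

definition left_invariant_metric ::
    "('a::topological_space, 'e::euclidean_space) chart set \<Rightarrow> ('a \<Rightarrow> 'a \<Rightarrow> 'a) \<Rightarrow> 'a mtensor \<Rightarrow> bool"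
  where "left_invariant_metric A mul g \<longleftrightarrow>
    (\<forall>a p. \<forall>u\<in>tangent_space A p. \<forall>v\<in>tangent_space A p.
       g (mul a p) (differential A (mul a) u) (differential A (mul a) v) = g p u v)"

definition unimodular ::
    "('a::topological_space, 'e::euclidean_space) chart set \<Rightarrow> ('a \<Rightarrow> 'a \<Rightarrow> 'a) \<Rightarrow> bool"
  where "unimodular A mul \<longleftrightarrow>
    (\<forall>X\<in>left_invariant_fields A mul. trace_on (left_invariant_fields A mul) (lie_bracket X) = 0)"

end

theory Submission
  imports Defs "HOL-Computational_Algebra.Polynomial"
begin

text \<open>On left-invariant fields \<open>Y\<close>, \<open>Z\<close> the function \<open>\<langle>Y, Z\<rangle>\<close> is constant, so with \<open>f = R - \<lambda>\<close> the soliton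
  equation at a point reads \<open>\<langle>ad\<^sub>X Y, Z\<rangle> + \<langle>Y, ad\<^sub>X Z\<rangle> = -2f \<langle>Y, Z\<rangle>\<close>. Contracting with a pair of dual bases
  of the Lie algebra turns the left-hand side into \<open>2 tr ad\<^sub>X = 0\<close>, hence \<open>f = 0\<close> unless the Lie
  algebra is trivial. The curvature plays no role. What has to be established about derivations is that
  the Lie algebra is finite-dimensional and that its evaluation at the identity is onto; both follow
  from Hadamard's lemma, which writes a derivation at a point as a directional derivative in a
  chart.\<close>

section \<open>Calculus of smooth maps\<close>

text \<open>Dual bases are used because \<open>g\<close> may be indefinite: they come from
  nondegeneracy alone, whatever the signature. Nondegeneracy of \<open>g\<close> at \<open>e\<close>
  is tested against all tangent vectors, that of the induced form on the Lie algebra only against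
  values of left-invariant fields; this is where surjectivity of evaluation enters. Finite dimension
  makes the trace a sum over a finite basis and lets injectivity give surjectivity when the dual
  basis is built. Tangent vectors act on global functions while a chart offers only local ones; bump
  functions bridge this gap. Once a derivation \<open>v\<close> at \<open>e\<close> is a directional
  derivative, sending \<open>q\<close> to the value of \<open>v\<close> on
  \<open>\<lambda>x. f (mul q x)\<close> is a partial derivative of a smooth function of two
  variables, hence smooth in \<open>q\<close>. The Lie algebra serves to show that the factor
  vanishes at each point; the equation for arbitrary vector fields then yields the Killing
  condition. A trivial Lie algebra says nothing about the factor, but then every tangent vector is
  zero and so are both sides of the equation.\<close>

lemma Ck_on_cong:
  assumes "open S" "\<And>x. x \<in> S \<Longrightarrow> f x = g x" "Ck_on k S f"
  shows "Ck_on k S g"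
  using assms(2,3)
proof (induction k arbitrary: f g)
  case 0
  then show ?case using continuous_on_cong[of S S f g] by simp
next
  case (Suc k)
  have D: "(g has_derivative frechet_derivative f (at x)) (at x)" if "x \<in> S" for x
    using Suc.prems that assms(1)
    by (metis Ck_on.simps(2) frechet_derivative_works has_derivative_transform_within_open)
  have eq: "frechet_derivative f (at x) v = frechet_derivative g (at x) v" if "x \<in> S" for x v
    using D[OF that] frechet_derivative_at by metis
  show ?case
    using Suc.IH[OF eq] Suc.prems(2) D by (auto simp: differentiable_def)
qed

text \<open>The derivative at a point is unique, so an explicit formula may stand in for the
  \<open>frechet_derivative\<close> in the recursion of \<open>Ck_on\<close>. The closure rules
  below rest on this.\<close>

lemma Ck_on_SucI:
  assumes "open S" "\<And>x. x \<in> S \<Longrightarrow> (f has_derivative f' x) (at x)"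
    and "\<And>v. Ck_on k S (\<lambda>x. f' x v)"
  shows "Ck_on (Suc k) S f"
proof -
  have eq: "f' x v = frechet_derivative f (at x) v" if "x \<in> S" for x v
    using assms(2)[OF that] frechet_derivative_at by metis
  show ?thesis
    using assms Ck_on_cong[OF assms(1) eq] by (auto simp: differentiable_def)
qed

lemma Ck_on_SucD:
  assumes "Ck_on (Suc k) S f" "x \<in> S"
  shows "(f has_derivative frechet_derivative f (at x)) (at x)"
  using assms frechet_derivative_works by auto

lemma Ck_on_Suc_imp: "Ck_on (Suc k) S f \<Longrightarrow> Ck_on k S f"
proof (induction k arbitrary: f)
  case 0
  then show ?case
    by (auto intro!: continuous_at_imp_continuous_on differentiable_imp_continuous_within)
next
  case (Suc k)
  then show ?case by (metis Ck_on.simps(2))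
qed

lemma Ck_on_imp_continuous_on: "Ck_on k S f \<Longrightarrow> continuous_on S f"
  by (induction k) (simp, metis Ck_on_Suc_imp)

lemma Ck_on_subset: "Ck_on k S f \<Longrightarrow> T \<subseteq> S \<Longrightarrow> Ck_on k T f"
  by (induction k arbitrary: f) (auto intro: continuous_on_subset)

lemma Ck_on_local:
  assumes "\<And>x. x \<in> S \<Longrightarrow> \<exists>T. open T \<and> x \<in> T \<and> Ck_on k T f"
  shows "Ck_on k S f"
  using assms
proof (induction k arbitrary: f)
  case 0
  then show ?case
    by (metis Ck_on.simps(1) continuous_at_imp_continuous_on continuous_on_eq_continuous_at)
next
  case (Suc k)
  have "Ck_on k S (\<lambda>x. frechet_derivative f (at x) v)" for v
    using Suc by (metis Ck_on.simps(2))
  then show ?case using Suc.prems by fastforce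
qed

lemma Ck_on_const: "open S \<Longrightarrow> Ck_on k S (\<lambda>_. c)"
proof (induction k arbitrary: c)
  case (Suc k)
  show ?case
    by (rule Ck_on_SucI[where f' = "\<lambda>_ _. 0"]) (use Suc in auto)
qed auto

lemma Ck_on_bounded_linear:
  assumes "open S" "bounded_linear h" "Ck_on k S f"
  shows "Ck_on k S (\<lambda>x. h (f x))"
  using assms(3)
proof (induction k arbitrary: f)
  case 0
  then show ?case using assms(2) by (auto intro: bounded_linear.continuous_on)
next
  case (Suc k)
  show ?case
    by (rule Ck_on_SucI[where f' = "\<lambda>x v. h (frechet_derivative f (at x) v)"])
       (use Suc assms in \<open>auto intro!: bounded_linear.has_derivative[OF assms(2)] simp: Ck_on_SucD[OF Suc.prems]\<close>)
qed

lemma Ck_on_linear: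
  assumes "open S" "bounded_linear h"
  shows "Ck_on k S h"
proof (cases k)
  case 0
  then show ?thesis using assms(2) by (simp add: linear_continuous_on)
next
  case (Suc n)
  have "Ck_on (Suc n) S h"
    by (rule Ck_on_SucI[where f' = "\<lambda>_. h"])
       (use assms in \<open>auto intro: Ck_on_const bounded_linear_imp_has_derivative\<close>)
  then show ?thesis using Suc by simp
qed

lemma Ck_on_add:
  assumes "open S" "Ck_on k S f" "Ck_on k S g"
  shows "Ck_on k S (\<lambda>x. f x + g x)"
  using assms(2,3)
proof (induction k arbitrary: f g)
  case 0
  then show ?case by (auto intro: continuous_intros)
next
  case (Suc k)
  show ?case
    by (rule Ck_on_SucI[where f' = "\<lambda>x v. frechet_derivative f (at x) v + frechet_derivative g (at x) v"])
       (use Suc assms(1) in \<open>auto intro!: has_derivative_add simp: Ck_on_SucD[OF Suc.prems(1)] Ck_on_SucD[OF Suc.prems(2)]\<close>)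
qed

lemma Ck_on_bilinear:
  assumes "open S" "bounded_bilinear h" "Ck_on k S f" "Ck_on k S g"
  shows "Ck_on k S (\<lambda>x. h (f x) (g x))"
  using assms(3,4)
proof (induction k arbitrary: f g)
  case 0
  then show ?case using bounded_bilinear.continuous_on[OF assms(2)] by auto
next
  case (Suc k)
  show ?case
  proof (rule Ck_on_SucI)
    fix x assume "x \<in> S"
    then show "((\<lambda>x. h (f x) (g x)) has_derivative
        (\<lambda>v. h (f x) (frechet_derivative g (at x) v) + h (frechet_derivative f (at x) v) (g x))) (at x)"
      by (intro bounded_bilinear.FDERIV[OF assms(2)] Ck_on_SucD[OF Suc.prems(1)] Ck_on_SucD[OF Suc.prems(2)])
  next
    fix v
    show "Ck_on k S (\<lambda>x. h (f x) (frechet_derivative g (at x) v) + h (frechet_derivative f (at x) v) (g x))"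
      using Suc.prems Ck_on_Suc_imp[OF Suc.prems(1)] Ck_on_Suc_imp[OF Suc.prems(2)]
      by (intro Ck_on_add assms(1) Suc.IH) auto
  qed (rule assms(1))
qed

lemma Ck_on_sum:
  assumes "open S" "\<And>i. i \<in> I \<Longrightarrow> Ck_on k S (f i)"
  shows "Ck_on k S (\<lambda>x. \<Sum>i\<in>I. f i x)"
  using assms(2)
proof (induction I rule: infinite_finite_induct)
  case (insert i I)
  then have "Ck_on k S (\<lambda>x. f i x + (\<Sum>i\<in>I. f i x))" by (intro Ck_on_add assms(1)) auto
  with insert show ?case by simp
qed (use assms(1) in \<open>auto intro: Ck_on_const\<close>)

lemma Ck_on_compose:
  fixes f :: "'x::real_normed_vector \<Rightarrow> 'y::euclidean_space"
    and g :: "'y \<Rightarrow> 'z::real_normed_vector"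
  assumes "open S" "open T" "f ` S \<subseteq> T" "Ck_on k S f" "Ck_on k T g"
  shows "Ck_on k S (\<lambda>x. g (f x))"
  using assms(4,5)
proof (induction k arbitrary: g)
  case 0
  then show ?case using assms(3) continuous_on_compose2 by auto
next
  case (Suc k)
  let ?f' = "\<lambda>x. frechet_derivative f (at x)"
  let ?g' = "\<lambda>x. frechet_derivative g (at x)"
  have fT: "f x \<in> T" if "x \<in> S" for x using that assms(3) by auto
  show ?case
  proof (rule Ck_on_SucI)
    fix x assume x: "x \<in> S"
    show "((\<lambda>x. g (f x)) has_derivative (\<lambda>v. ?g' (f x) (?f' x v))) (at x)"
      using diff_chain_at[OF Ck_on_SucD[OF Suc.prems(1) x] Ck_on_SucD[OF Suc.prems(2) fT[OF x]]]
      by (simp add: o_def)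
  next
    fix v
    \<comment> \<open>In \<open>?g' (f x) (?f' x v)\<close> both the linear map and its argument
      vary with \<open>x\<close>. Expanding the argument in \<open>Basis\<close> leaves products in
      which \<open>?g'\<close> is applied to a fixed \<open>b\<close>, and these fall under the
      induction hypothesis.\<close>
    have "(\<Sum>b\<in>Basis. (?f' x v \<bullet> b) *\<^sub>R ?g' (f x) b) = ?g' (f x) (?f' x v)" if x: "x \<in> S" for x
    proof -
      interpret bounded_linear "?g' (f x)"
        using Ck_on_SucD[OF Suc.prems(2) fT[OF x]] by (rule has_derivative_bounded_linear)
      have "?g' (f x) (?f' x v) = ?g' (f x) (\<Sum>b\<in>Basis. (?f' x v \<bullet> b) *\<^sub>R b)"
        by (simp only: euclidean_representation)
      then show ?thesis by (simp only: sum scaleR)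
    qed
    moreover have "Ck_on k S (\<lambda>x. \<Sum>b\<in>Basis. (?f' x v \<bullet> b) *\<^sub>R ?g' (f x) b)"
      using Suc.prems Ck_on_Suc_imp[OF Suc.prems(1)]
      by (intro Ck_on_sum Ck_on_bilinear[OF _ bounded_bilinear_scaleR]
          Ck_on_bounded_linear[OF _ bounded_linear_inner_left] Suc.IH assms(1)) auto
    ultimately show "Ck_on k S (\<lambda>x. ?g' (f x) (?f' x v))"
      by (rule Ck_on_cong[OF assms(1)])
  qed (rule assms(1))
qed

section \<open>Closure rules for smooth maps\<close>

lemma smooth_on_cong:
  "open S \<Longrightarrow> (\<And>x. x \<in> S \<Longrightarrow> f x = g x) \<Longrightarrow> smooth_on S f \<Longrightarrow> smooth_on S g"
  unfolding smooth_on_def using Ck_on_cong[of S f g] by simp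

lemma smooth_on_subset: "smooth_on S f \<Longrightarrow> T \<subseteq> S \<Longrightarrow> smooth_on T f"
  unfolding smooth_on_def using Ck_on_subset[of _ S f T] by simp

lemma smooth_on_local:
  "(\<And>x. x \<in> S \<Longrightarrow> \<exists>T. open T \<and> x \<in> T \<and> smooth_on T f) \<Longrightarrow> smooth_on S f"
  unfolding smooth_on_def by (intro allI Ck_on_local) metis

lemma smooth_on_const: "open S \<Longrightarrow> smooth_on S (\<lambda>_. c)"
  unfolding smooth_on_def by (simp add: Ck_on_const)

lemma smooth_on_bounded_linear: "open S \<Longrightarrow> bounded_linear h \<Longrightarrow> smooth_on S h"
  unfolding smooth_on_def by (simp add: Ck_on_linear)

lemma smooth_on_add: "open S \<Longrightarrow> smooth_on S f \<Longrightarrow> smooth_on S g \<Longrightarrow> smooth_on S (\<lambda>x. f x + g x)"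
  unfolding smooth_on_def by (simp add: Ck_on_add)

lemma smooth_on_bilinear:
  "open S \<Longrightarrow> bounded_bilinear h \<Longrightarrow> smooth_on S f \<Longrightarrow> smooth_on S g \<Longrightarrow> smooth_on S (\<lambda>x. h (f x) (g x))"
  unfolding smooth_on_def by (simp add: Ck_on_bilinear)

lemma smooth_on_mult:
  fixes f g :: "_ \<Rightarrow> real"
  shows "open S \<Longrightarrow> smooth_on S f \<Longrightarrow> smooth_on S g \<Longrightarrow> smooth_on S (\<lambda>x. f x * g x)"
  by (rule smooth_on_bilinear[OF _ bounded_bilinear_mult])

lemma smooth_on_compose:
  fixes f :: "_ \<Rightarrow> 'y::euclidean_space"
  shows "open S \<Longrightarrow> open T \<Longrightarrow> f ` S \<subseteq> T \<Longrightarrow> smooth_on S f \<Longrightarrow> smooth_on T g \<Longrightarrow> smooth_on S (\<lambda>x. g (f x))"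
  unfolding smooth_on_def using Ck_on_compose[of S T f _ g] by simp

lemma smooth_on_has_derivative:
  "smooth_on S f \<Longrightarrow> x \<in> S \<Longrightarrow> (f has_derivative frechet_derivative f (at x)) (at x)"
  unfolding smooth_on_def using Ck_on_SucD[of 0 S f x] by simp

lemma smooth_on_frechet_derivative:
  "smooth_on S f \<Longrightarrow> smooth_on S (\<lambda>x. frechet_derivative f (at x) v)"
  unfolding smooth_on_def using Ck_on.simps(2)[of _ S f] by simp

lemma smooth_on_imp_continuous_on: "smooth_on S f \<Longrightarrow> continuous_on S f"
  unfolding smooth_on_def using Ck_on.simps(1)[of S f] by simp

lemma smooth_on_Pair_right:
  assumes "open S"
  shows "smooth_on S (\<lambda>y::'x::real_normed_vector. (c::'y::real_normed_vector, y))"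
proof -
  have "bounded_linear (\<lambda>y::'x::real_normed_vector. (0::'y, y))"
    by (intro bounded_linear_Pair bounded_linear_zero bounded_linear_ident)
  from smooth_on_add[OF assms smooth_on_const[OF assms, of "(c, 0)"] smooth_on_bounded_linear[OF assms this]]
  show ?thesis by simp
qed

lemma smooth_on_Pair_left:
  assumes "open S"
  shows "smooth_on S (\<lambda>y::'x::real_normed_vector. (y, c::'y::real_normed_vector))"
proof -
  have "bounded_linear (\<lambda>y::'x::real_normed_vector. (y, 0::'y::real_normed_vector))"
    by (intro bounded_linear_Pair bounded_linear_zero bounded_linear_ident)
  from smooth_on_add[OF assms smooth_on_const[OF assms, of "(0, c)"] smooth_on_bounded_linear[OF assms this]]
  show ?thesis by simp
qed

text \<open>The functions \<open>p (1/x) exp (-1/x)\<close>, extended by \<open>0\<close>, are closed under differentiation, which makes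
  them smooth.\<close>

definition flat_poly :: "real poly \<Rightarrow> real \<Rightarrow> real"
  where "flat_poly p x = (if x > 0 then poly p (1/x) * exp (- (1/x)) else 0)"

lemma poly_exp_tendsto_0: "((\<lambda>x. poly p x * exp (- x)) \<longlongrightarrow> 0) (at_top :: real filter)"
proof (induction p)
  case (pCons a p)
  have mono: "((\<lambda>x. c * x ^ n * exp (-x)) \<longlongrightarrow> 0) (at_top :: real filter)" for c n
    using tendsto_mult[OF tendsto_const[of c] tendsto_power_div_exp_0[of n]]
    by (simp add: exp_minus field_simps)
  have eq: "poly q x * exp (-x) = (\<Sum>i\<le>degree q. coeff q i * x ^ i * exp (-x))" for q :: "real poly" and x
    by (simp add: poly_altdef sum_distrib_right)
  show ?case unfolding eq
    using tendsto_sum[of "{..degree (pCons a p)}" _ "\<lambda>_. 0" at_top, OF mono] by simp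
qed auto

text \<open>With \<open>s = 1/x\<close>, differentiation in \<open>x\<close> is \<open>- s^2\<close>
  times differentiation in \<open>s\<close>, and \<open>p(s) exp(-s)\<close> has
  \<open>s\<close>-derivative \<open>(p'(s) - p(s)) exp(-s)\<close>; hence the polynomial
  \<open>s^2 (p - p')\<close>. At 0 the right difference quotient is \<open>s p(s) exp(-s)\<close>,
  which tends to 0 as \<open>s\<close> grows.\<close>

lemma flat_poly_has_derivative:
  "(flat_poly p has_field_derivative flat_poly (pCons 0 (pCons 0 (p - pderiv p))) x) (at x)"
proof -
  consider "x > 0" | "x < 0" | "x = 0" by linarith
  then show ?thesis
  proof cases
    case 1
    have "((\<lambda>x. poly p (1/x) * exp (- (1/x))) has_field_derivative
        flat_poly (pCons 0 (pCons 0 (p - pderiv p))) x) (at x)"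
      using 1 by (auto intro!: derivative_eq_intros simp: flat_poly_def field_simps power2_eq_square)
    then show ?thesis
      by (rule has_field_derivative_transform_within_open[of _ _ _ "{0<..}"]) (use 1 in \<open>auto simp: flat_poly_def\<close>)
  next
    case 2
    have "((\<lambda>x. 0) has_field_derivative flat_poly (pCons 0 (pCons 0 (p - pderiv p))) x) (at x)"
      using 2 by (auto simp: flat_poly_def)
    then show ?thesis
      by (rule has_field_derivative_transform_within_open[of _ _ _ "{..<0}"]) (use 2 in \<open>auto simp: flat_poly_def\<close>)
  next
    case 3
    have R: "((\<lambda>x. flat_poly p x / x) \<longlongrightarrow> 0) (at_right 0)"
    proof -
      have "((\<lambda>x. poly (pCons 0 p) (inverse x) * exp (- inverse x)) \<longlongrightarrow> 0) (at_right (0::real))"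
        by (rule filterlim_compose[OF poly_exp_tendsto_0 filterlim_inverse_at_top_right])
      moreover have "\<forall>\<^sub>F x in at_right 0. poly (pCons 0 p) (inverse x) * exp (- inverse x) = flat_poly p x / x"
        using eventually_at_right_less by eventually_elim (auto simp: flat_poly_def divide_inverse)
      ultimately show ?thesis by (rule Lim_transform_eventually)
    qed
    have L: "((\<lambda>x. flat_poly p x / x) \<longlongrightarrow> 0) (at_left 0)"
    proof -
      have "\<forall>\<^sub>F x in at_left 0. flat_poly p x / x = 0"
        unfolding eventually_at_left_field by (rule exI[of _ "-1"]) (auto simp: flat_poly_def)
      then show ?thesis by (rule tendsto_eventually)
    qed
    show ?thesis
      using filterlim_split_at[OF L R] 3 by (simp add: has_field_derivative_iff flat_poly_def)
  qed
qed

lemma smooth_on_flat_poly: "open S \<Longrightarrow> smooth_on S (flat_poly p)"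
proof -
  assume S: "open S"
  have "Ck_on k S (flat_poly p)" for k
  proof (induction k arbitrary: p)
    case 0
    show ?case
      using flat_poly_has_derivative by (auto intro!: continuous_at_imp_continuous_on DERIV_isCont)
  next
    case (Suc k)
    show ?case
    proof (rule Ck_on_SucI)
      show "(flat_poly p has_derivative (\<lambda>v. flat_poly (pCons 0 (pCons 0 (p - pderiv p))) x * v)) (at x)" for x
        using flat_poly_has_derivative has_field_derivative_def by blast
      show "Ck_on k S (\<lambda>x. flat_poly (pCons 0 (pCons 0 (p - pderiv p))) x * v)" for v
        by (intro Ck_on_bounded_linear[OF S bounded_linear_mult_left] Suc)
    qed (rule S)
  qed
  then show ?thesis by (simp add: smooth_on_def)
qed

text \<open>Squared norms keep the argument of \<open>flat_poly\<close> smooth at the centre, where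
  the norm itself is not.\<close>

definition bump :: "'e::euclidean_space \<Rightarrow> real \<Rightarrow> 'e \<Rightarrow> real"
  where "bump c r y = flat_poly 1 (r\<^sup>2 - (norm (y - c))\<^sup>2)"

lemma bump_center_pos: "r > 0 \<Longrightarrow> bump c r c > 0"
  by (simp add: bump_def flat_poly_def)

lemma bump_outside: "r > 0 \<Longrightarrow> y \<notin> ball c r \<Longrightarrow> bump c r y = 0"
  by (auto simp: bump_def flat_poly_def dist_norm norm_minus_commute not_less intro!: power_mono)

lemma smooth_on_bump: "open S \<Longrightarrow> smooth_on S (bump c r)"
proof -
  assume S: "open S"
  have 1: "smooth_on S (\<lambda>y. y + (-c))"
    using S by (intro smooth_on_add smooth_on_bounded_linear smooth_on_const bounded_linear_ident)
  have "smooth_on S (\<lambda>y. r\<^sup>2 + (-1) * ((y + -c) \<bullet> (y + -c)))"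
    by (intro smooth_on_add smooth_on_mult smooth_on_const smooth_on_bilinear[OF _ bounded_bilinear_inner] S 1)
  from this have "smooth_on S (\<lambda>y. flat_poly 1 (r\<^sup>2 + (-1) * ((y + -c) \<bullet> (y + -c))))"
    by (rule smooth_on_compose[OF S open_UNIV subset_UNIV _ smooth_on_flat_poly[OF open_UNIV]])
  then show ?thesis
    by (simp add: bump_def[abs_def] power2_norm_eq_inner)
qed

section \<open>Hadamard's lemma by integration along rays\<close>

lemma ray_in_ball:
  fixes y c :: "'e::real_normed_vector"
  assumes "y \<in> ball c R" "t \<in> {0..1}"
  shows "c + t *\<^sub>R (y - c) \<in> ball c R"
proof -
  have "\<bar>t\<bar> * norm (y - c) \<le> 1 * norm (y - c)" using assms(2) by (intro mult_right_mono) auto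
  then show ?thesis using assms by (simp add: dist_norm norm_minus_commute)
qed

text \<open>The factor \<open>t ^ j\<close> is what keeps the induction going: each differentiation under the integral brings
  out another \<open>t\<close>.\<close>

lemma Ck_on_ray_integral:
  fixes G :: "'e::euclidean_space \<Rightarrow> real"
  assumes "Ck_on k (ball c R) G"
  shows "Ck_on k (ball c R) (\<lambda>y. integral {0..1} (\<lambda>t. t ^ j * G (c + t *\<^sub>R (y - c))))"
  using assms
proof (induction k arbitrary: G j)
  case 0
  note mem = ray_in_ball[of _ c R]
  have "continuous_on (ball c R \<times> cbox 0 1) (\<lambda>(y, t). t ^ j * G (c + t *\<^sub>R (y - c)))"
    unfolding split_beta
  proof (intro continuous_on_mult continuous_on_compose2[OF 0[unfolded Ck_on.simps]])
    show "(\<lambda>z. c + snd z *\<^sub>R (fst z - c)) ` (ball c R \<times> cbox 0 1) \<subseteq> ball c R"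
      by (rule image_subsetI) (auto intro!: mem simp del: mem_ball)
  qed (use 0 in \<open>auto intro!: continuous_intros\<close>)
  then have "continuous_on (ball c R) (\<lambda>y. integral (cbox 0 1) (\<lambda>t. t ^ j * G (c + t *\<^sub>R (y - c))))"
    by (rule integral_continuous_on_param)
  then show ?case by simp
next
  case (Suc k)
  note mem = ray_in_ball[of _ c R]
  let ?G' = "\<lambda>y. frechet_derivative G (at y)"
  have bl: "bounded_linear (?G' y)" if "y \<in> ball c R" for y
    using Ck_on_SucD[OF Suc.prems that] has_derivative_bounded_linear by blast
  \<comment> \<open>The Leibniz rule for parameter integrals takes the derivative as a map into
    bounded linear operators.\<close>
  define F' where "F' y t = Blinfun (\<lambda>v. t ^ Suc j * ?G' (c + t *\<^sub>R (y - c)) v)" for y t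
  have F': "blinfun_apply (F' y t) = (\<lambda>v. t ^ Suc j * ?G' (c + t *\<^sub>R (y - c)) v)"
    if "y \<in> ball c R" "t \<in> {0..1}" for y t
    unfolding F'_def
    by (rule bounded_linear_Blinfun_apply) (intro bounded_linear_const_mult bl mem that)
  have contG: "continuous_on (ball c R) G"
    using Suc.prems by (rule Ck_on_imp_continuous_on)
  have contG': "continuous_on (ball c R) (\<lambda>y. ?G' y v)" for v
    using Suc.prems by (intro Ck_on_imp_continuous_on[of k]) simp
  have cont: "continuous_on (ball c R \<times> {0..1}) (\<lambda>(y, t). F' y t)"
  \<comment> \<open>In finite dimension, continuity in the operator norm can be checked on basis
    vectors.\<close>
  proof (rule continuous_on_blinfun_componentwise)
    fix i :: 'e
    have "continuous_on (ball c R \<times> {0..1}) (\<lambda>z. snd z ^ Suc j * ?G' (c + snd z *\<^sub>R (fst z - c)) i)"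
    proof (intro continuous_on_mult continuous_on_compose2[OF contG'])
      show "(\<lambda>z. c + snd z *\<^sub>R (fst z - c)) ` (ball c R \<times> {0..1}) \<subseteq> ball c R"
        by (rule image_subsetI) (auto intro!: mem simp del: mem_ball)
    qed (auto intro!: continuous_intros)
    then show "continuous_on (ball c R \<times> {0..1}) (\<lambda>x. blinfun_apply (case x of (y, t) \<Rightarrow> F' y t) i)"
      by (rule continuous_on_cong[THEN iffD1, rotated 2]) (auto simp: F')
  qed
  have deriv: "((\<lambda>y. integral (cbox 0 1) (\<lambda>t. t ^ j * G (c + t *\<^sub>R (y - c))))
      has_derivative blinfun_apply (integral (cbox 0 1) (F' y))) (at y within ball c R)"
    if y: "y \<in> ball c R" for y
  proof (rule leibniz_rule[where fx = F'])
    fix x t assume x: "x \<in> ball c R" and t: "t \<in> cbox (0::real) 1"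
    have t': "t \<in> {0..1}" using t by simp
    have "((\<lambda>y. t ^ j * G (c + t *\<^sub>R (y - c))) has_derivative
       (\<lambda>v. t ^ j * ?G' (c + t *\<^sub>R (x - c)) (t *\<^sub>R v))) (at x)"
      by (intro has_derivative_mult_right has_derivative_compose[where f = "\<lambda>y. c + t *\<^sub>R (y - c)", OF _ Ck_on_SucD[OF Suc.prems mem[OF x t']]])
         (auto intro!: derivative_eq_intros)
    moreover have "(\<lambda>v. t ^ j * ?G' (c + t *\<^sub>R (x - c)) (t *\<^sub>R v)) = blinfun_apply (F' x t)"
      unfolding F'[OF x t'] using bl[OF mem[OF x t']]
      by (auto simp: linear_simps bounded_linear.linear linear_cmul)
    ultimately show "((\<lambda>x. t ^ j * G (c + t *\<^sub>R (x - c))) has_derivative blinfun_apply (F' x t))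
        (at x within ball c R)"
      by (simp add: has_derivative_at_withinI)
  next
    fix x assume x: "x \<in> ball c R"
    have "continuous_on (cbox 0 1) (\<lambda>t. t ^ j * G (c + t *\<^sub>R (x - c)))"
    proof (intro continuous_on_mult continuous_on_compose2[OF contG])
      show "(\<lambda>t. c + t *\<^sub>R (x - c)) ` cbox 0 1 \<subseteq> ball c R"
        by (rule image_subsetI) (auto intro!: mem x simp del: mem_ball)
    qed (auto intro!: continuous_intros)
    then show "(\<lambda>t. t ^ j * G (c + t *\<^sub>R (x - c))) integrable_on cbox 0 1"
      by (rule integrable_continuous)
  next
    show "continuous_on (ball c R \<times> cbox 0 1) (\<lambda>(y, t). F' y t)"
      using cont by (simp only: cbox_interval)
  qed (rule y, rule convex_ball)
  show ?case
  proof (rule Ck_on_SucI[where f' = "\<lambda>y. blinfun_apply (integral {0..1} (F' y))"])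
    fix y assume y: "y \<in> ball c R"
    show "((\<lambda>y. integral {0..1} (\<lambda>t. t ^ j * G (c + t *\<^sub>R (y - c)))) has_derivative
        blinfun_apply (integral {0..1} (F' y))) (at y)"
      using deriv[OF y] unfolding at_within_open[OF y open_ball] cbox_interval .
  next
    fix v
    \<comment> \<open>Evaluation at \<open>v\<close> commutes with the integral and leaves a scalar
      ray integral with exponent \<open>Suc j\<close>, to which the induction hypothesis
      applies.\<close>
    have "integral {0..1} (\<lambda>t. t ^ Suc j * ?G' (c + t *\<^sub>R (y - c)) v)
        = blinfun_apply (integral {0..1} (F' y)) v" if y: "y \<in> ball c R" for y
    proof -
      have "continuous_on {0..1} (\<lambda>t. case (y, t) of (y, t) \<Rightarrow> F' y t)"
        by (rule continuous_on_compose2[OF cont, where f = "Pair y"])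
           (use y in \<open>auto intro: continuous_on_Pair continuous_on_const continuous_on_id simp del: mem_ball\<close>)
      then have "F' y integrable_on {0..1}"
        unfolding prod.case by (rule integrable_continuous_interval)
      from integral_linear[OF this blinfun.bounded_linear_left[of v]]
      have "blinfun_apply (integral {0..1} (F' y)) v = integral {0..1} (\<lambda>t. blinfun_apply (F' y t) v)"
        by (simp only: o_def)
      also have "\<dots> = integral {0..1} (\<lambda>t. t ^ Suc j * ?G' (c + t *\<^sub>R (y - c)) v)"
        by (rule integral_cong) (simp only: F'[OF y])
      finally show ?thesis by (rule sym)
    qed
    moreover have "Ck_on k (ball c R) (\<lambda>y. integral {0..1} (\<lambda>t. t ^ Suc j * ?G' (c + t *\<^sub>R (y - c)) v))"
      using Suc.prems by (intro Suc.IH) simp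
    ultimately show "Ck_on k (ball c R) (\<lambda>y. blinfun_apply (integral {0..1} (F' y)) v)"
      by (rule Ck_on_cong[OF open_ball])
  qed simp
qed

text \<open>By the fundamental theorem of calculus, \<open>F y - F c\<close> is the integral of the
  derivative of \<open>F\<close> along the ray from \<open>c\<close> to \<open>y\<close>, applied to
  \<open>y - c\<close>. Expanding \<open>y - c\<close> in \<open>Basis\<close> gives
  \<open>G b\<close> as the ray integral of the partial derivative along \<open>b\<close>; at
  \<open>y = c\<close> its integrand is constant.\<close>

lemma hadamard:
  fixes F :: "'e::euclidean_space \<Rightarrow> real"
  assumes F: "smooth_on (ball c R) F" and R: "R > 0"
  obtains G where "\<And>b. smooth_on (ball c R) (G b)"
    "\<And>y. y \<in> ball c R \<Longrightarrow> F y = F c + (\<Sum>b\<in>Basis. ((y - c) \<bullet> b) * G b y)"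
    "\<And>b. G b c = frechet_derivative F (at c) b"
proof
  let ?F' = "\<lambda>y. frechet_derivative F (at y)"
  let ?G = "\<lambda>b y. integral {0..1} (\<lambda>t. t ^ 0 * ?F' (c + t *\<^sub>R (y - c)) b)"
  show "smooth_on (ball c R) (?G b)" for b
    using smooth_on_frechet_derivative[OF F] Ck_on_ray_integral unfolding smooth_on_def by blast
  show "?G b c = frechet_derivative F (at c) b" for b
    by simp
  fix y assume y: "y \<in> ball c R"
  note mem = ray_in_ball[OF y]
  have cont: "continuous_on {0..1} (\<lambda>t. ?F' (c + t *\<^sub>R (y - c)) b)" for b
    using mem
    by (intro continuous_on_compose2[OF smooth_on_imp_continuous_on[OF smooth_on_frechet_derivative[OF F]]]
         continuous_intros) auto
  have "((\<lambda>t. ?F' (c + t *\<^sub>R (y - c)) (y - c)) has_integral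
      F (c + 1 *\<^sub>R (y - c)) - F (c + 0 *\<^sub>R (y - c))) {0..1}"
  proof (rule fundamental_theorem_of_calculus)
    fix t :: real assume t: "t \<in> {0..1}"
    note D = smooth_on_has_derivative[OF F mem[OF t]]
    have "((\<lambda>t. F (c + t *\<^sub>R (y - c))) has_derivative (\<lambda>s. ?F' (c + t *\<^sub>R (y - c)) (s *\<^sub>R (y - c))))
        (at t within {0..1})"
      by (rule has_derivative_compose[where f = "\<lambda>t. c + t *\<^sub>R (y - c)", OF _ D]) (auto intro!: derivative_eq_intros)
    moreover have "(\<lambda>s. ?F' (c + t *\<^sub>R (y - c)) (s *\<^sub>R (y - c))) = (\<lambda>s. s *\<^sub>R ?F' (c + t *\<^sub>R (y - c)) (y - c))"
      using has_derivative_bounded_linear[OF D] by (auto simp: bounded_linear.linear linear_cmul)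
    ultimately show "((\<lambda>t. F (c + t *\<^sub>R (y - c))) has_vector_derivative ?F' (c + t *\<^sub>R (y - c)) (y - c))
        (at t within {0..1})"
      by (simp add: has_vector_derivative_def)
  qed simp
  then have "F y - F c = integral {0..1} (\<lambda>t. ?F' (c + t *\<^sub>R (y - c)) (y - c))"
    by (simp add: integral_unique)
  also have "\<dots> = integral {0..1} (\<lambda>t. \<Sum>b\<in>Basis. ((y - c) \<bullet> b) * ?F' (c + t *\<^sub>R (y - c)) b)"
  proof (rule integral_cong)
    fix t :: real assume t: "t \<in> {0..1}"
    interpret bounded_linear "?F' (c + t *\<^sub>R (y - c))"
      using smooth_on_has_derivative[OF F mem[OF t]] by (rule has_derivative_bounded_linear)
    have "?F' (c + t *\<^sub>R (y - c)) (y - c) = ?F' (c + t *\<^sub>R (y - c)) (\<Sum>b\<in>Basis. ((y - c) \<bullet> b) *\<^sub>R b)"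
      by (simp only: euclidean_representation)
    then show "?F' (c + t *\<^sub>R (y - c)) (y - c) = (\<Sum>b\<in>Basis. ((y - c) \<bullet> b) * ?F' (c + t *\<^sub>R (y - c)) b)"
      by (simp only: sum scaleR real_scaleR_def)
  qed
  also have "\<dots> = (\<Sum>b\<in>Basis. ((y - c) \<bullet> b) * ?G b y)"
    using cont by (subst integral_sum) (auto intro!: integrable_continuous_interval continuous_intros)
  finally show "F y = F c + (\<Sum>b\<in>Basis. ((y - c) \<bullet> b) * ?G b y)" by simp
qed

section \<open>Derivations and vector fields on manifolds\<close>

lemma is_chartD:
  assumes "is_chart (U, \<phi>)"
  shows "open U" "open (\<phi> ` U)" "inj_on \<phi> U" "homeomorphism U (\<phi> ` U) \<phi> (inv_into U \<phi>)"
proof -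
  show "open U" "open (\<phi> ` U)" and h: "homeomorphism U (\<phi> ` U) \<phi> (inv_into U \<phi>)"
    using assms by (simp_all add: is_chart_def)
  show "inj_on \<phi> U"
    by (rule inj_on_inverseI[of _ "inv_into U \<phi>"]) (rule homeomorphism_apply1[OF h])
qed

lemma is_chart_open_image:
  assumes "is_chart (U, \<phi>)" "open W"
  shows "open (\<phi> ` (U \<inter> W))"
proof -
  note c = is_chartD[OF assms(1)]
  have "openin (top_of_set U) (U \<inter> W)" using assms(2) by auto
  then have "openin (top_of_set (\<phi> ` U)) (\<phi> ` (U \<inter> W))"
    by (rule homeomorphism_imp_open_map[OF c(4)])
  then show ?thesis using c(2) openin_open_trans by blast
qed

lemma is_chart_open_preimage:
  assumes "is_chart (U, \<phi>)" "open B" "B \<subseteq> \<phi> ` U"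
  shows "open (inv_into U \<phi> ` B)"
proof -
  note c = is_chartD[OF assms(1)]
  have "openin (top_of_set (\<phi> ` U)) B" using assms(2,3) open_subset by blast
  then have "openin (top_of_set U) (inv_into U \<phi> ` B)"
    using homeomorphism_imp_open_map c(4) homeomorphism_sym by blast
  then show ?thesis using c(1) openin_open_trans by blast
qed

lemma is_chart_ball:
  assumes "is_chart (U, \<phi>)" "p \<in> U"
  obtains R where "R > 0" "ball (\<phi> p) R \<subseteq> \<phi> ` U"
  using is_chartD(2)[OF assms(1)] assms(2) open_contains_ball by blast

locale smooth_manifold =
  fixes A :: "('a::{t2_space,second_countable_topology}, 'e::euclidean_space) chart set"
  assumes atlas: "smooth_atlas A"
begin

abbreviation "SF \<equiv> smooth_functions A"

lemma chart: "(U, \<phi>) \<in> A \<Longrightarrow> is_chart (U, \<phi>)"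
  using atlas by (auto simp: smooth_atlas_def)

lemma chart_at:
  obtains U \<phi> where "(U, \<phi>) \<in> A" "p \<in> U"
proof -
  have "p \<in> (\<Union>(U, \<phi>)\<in>A. U)" using atlas by (simp add: smooth_atlas_def)
  then show ?thesis using that by auto
qed

text \<open>Transition maps carry smoothness from one chart to any other, so one convenient chart
  near each point is enough.\<close>

lemma SF_local:
  assumes "\<And>p. \<exists>U \<phi> W. (U, \<phi>) \<in> A \<and> open W \<and> p \<in> W \<and> W \<subseteq> U \<and> smooth_on (\<phi> ` W) (f \<circ> inv_into U \<phi>)"
  shows "f \<in> SF"
proof -
  have "smooth_on (\<psi> ` V) (f \<circ> inv_into V \<psi>)" if V: "(V, \<psi>) \<in> A" for V \<psi>
  proof (rule smooth_on_local)
    fix z assume "z \<in> \<psi> ` V"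
    then obtain q where q: "q \<in> V" "z = \<psi> q" by auto
    obtain U \<phi> W where U: "(U, \<phi>) \<in> A" and W: "open W" "q \<in> W" "W \<subseteq> U"
      and sm: "smooth_on (\<phi> ` W) (f \<circ> inv_into U \<phi>)"
      using assms by blast
    let ?T = "\<psi> ` (V \<inter> W)"
    have oT: "open ?T" by (rule is_chart_open_image[OF chart[OF V] W(1)])
    have oW: "open (\<phi> ` W)"
      using is_chart_open_image[OF chart[OF U] W(1)] W(3) by (simp add: inf.absorb2)
    have "smooth_on (\<psi> ` (V \<inter> U)) (\<phi> \<circ> inv_into V \<psi>)"
      using atlas V U by (auto simp: smooth_atlas_def)
    then have tr: "smooth_on ?T (\<phi> \<circ> inv_into V \<psi>)"
      by (rule smooth_on_subset) (use W(3) in auto)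
    have inv: "inv_into V \<psi> (\<psi> x) = x" if "x \<in> V" for x
      using that is_chartD(3)[OF chart[OF V]] by simp
    have inv': "inv_into U \<phi> (\<phi> x) = x" if "x \<in> W" for x
      using that W(3) is_chartD(3)[OF chart[OF U]] by auto
    have "smooth_on ?T (\<lambda>z. (f \<circ> inv_into U \<phi>) ((\<phi> \<circ> inv_into V \<psi>) z))"
      by (rule smooth_on_compose[OF oT oW _ tr sm]) (auto simp: inv)
    then have "smooth_on ?T (f \<circ> inv_into V \<psi>)"
      by (rule smooth_on_cong[OF oT, rotated]) (auto simp: inv inv')
    then show "\<exists>T. open T \<and> z \<in> T \<and> smooth_on T (f \<circ> inv_into V \<psi>)"
      using oT q W(2) by blast
  qed
  then show ?thesis by (auto simp: smooth_functions_def)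
qed

lemma SF_chart:
  assumes "f \<in> SF" "(U, \<phi>) \<in> A"
  shows "smooth_on (\<phi> ` U) (\<lambda>y. f (inv_into U \<phi> y))"
  using assms unfolding smooth_functions_def o_def by blast

lemma SF_I:
  assumes "\<And>U \<phi>. (U, \<phi>) \<in> A \<Longrightarrow> smooth_on (\<phi> ` U) (\<lambda>y. f (inv_into U \<phi> y))"
  shows "f \<in> SF"
  using assms unfolding smooth_functions_def o_def by auto

lemma SF_const: "(\<lambda>_. c) \<in> SF"
  by (rule SF_I) (rule smooth_on_const[OF is_chartD(2)[OF chart]])

lemma SF_add: "f \<in> SF \<Longrightarrow> h \<in> SF \<Longrightarrow> (\<lambda>x. f x + h x) \<in> SF"
  by (rule SF_I) (rule smooth_on_add[OF is_chartD(2)[OF chart] SF_chart SF_chart])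

lemma SF_mult: "f \<in> SF \<Longrightarrow> h \<in> SF \<Longrightarrow> (\<lambda>x. f x * h x) \<in> SF"
  by (rule SF_I) (rule smooth_on_mult[OF is_chartD(2)[OF chart] SF_chart SF_chart])

lemma SF_diff: "f \<in> SF \<Longrightarrow> h \<in> SF \<Longrightarrow> (\<lambda>x. f x - h x) \<in> SF"
  using SF_add[of f "\<lambda>x. (-1) * h x"] SF_mult[OF SF_const[of "-1"], of h] by simp

lemma SF_sum: "(\<And>i. i \<in> I \<Longrightarrow> f i \<in> SF) \<Longrightarrow> (\<lambda>x. \<Sum>i\<in>I. f i x) \<in> SF"
  by (induction I rule: infinite_finite_induct) (auto simp: SF_const SF_add)

text \<open>This turns a function \<open>u\<close> of the coordinates into a function on the whole
  manifold, to which derivations can be applied.\<close>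

definition bump_extend :: "'a set \<Rightarrow> ('a \<Rightarrow> 'e) \<Rightarrow> 'e \<Rightarrow> real \<Rightarrow> ('e \<Rightarrow> real) \<Rightarrow> 'a \<Rightarrow> real"
  where "bump_extend U \<phi> c r u x = (if x \<in> U then bump c r (\<phi> x) * u (\<phi> x) else 0)"

text \<open>Two open sets cover the manifold: the part of the chart over \<open>ball c R\<close>,
  where the function is a product of smooth ones, and the complement of the part over
  \<open>cball c r\<close>, where it is 0. Because \<open>r < R\<close>, the latter part is compact,
  hence closed in a Hausdorff space.\<close>

lemma bump_extend_smooth:
  assumes U: "(U, \<phi>) \<in> A" and r: "0 < r" "r < R" and R: "ball c R \<subseteq> \<phi> ` U"
    and u: "smooth_on (ball c R) u"
  shows "bump_extend U \<phi> c r u \<in> SF"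
proof (rule SF_local)
  fix q
  note c = is_chartD[OF chart[OF U]]
  have inv: "\<phi> (inv_into U \<phi> y) = y" "inv_into U \<phi> y \<in> U" if "y \<in> ball c R" for y
    using subsetD[OF R that] by (auto intro: f_inv_into_f inv_into_into)
  show "\<exists>V \<psi> W. (V, \<psi>) \<in> A \<and> open W \<and> q \<in> W \<and> W \<subseteq> V \<and>
          smooth_on (\<psi> ` W) (bump_extend U \<phi> c r u \<circ> inv_into V \<psi>)"
  proof (cases "q \<in> inv_into U \<phi> ` ball c R")
    case True
    let ?W = "inv_into U \<phi> ` ball c R"
    have im: "\<phi> ` ?W = ball c R" using inv by force
    have "smooth_on (ball c R) (\<lambda>y. bump c r y * u y)"
      by (intro smooth_on_mult smooth_on_bump u open_ball)
    then have "smooth_on (ball c R) (bump_extend U \<phi> c r u \<circ> inv_into U \<phi>)"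
      by (rule smooth_on_cong[OF open_ball, rotated]) (use inv in \<open>simp add: bump_extend_def\<close>)
    then have "smooth_on (\<phi> ` ?W) (bump_extend U \<phi> c r u \<circ> inv_into U \<phi>)"
      by (simp only: im)
    moreover have "open ?W" by (rule is_chart_open_preimage[OF chart[OF U] open_ball R])
    moreover have "?W \<subseteq> U" using inv by blast
    ultimately show ?thesis using U True by blast
  next
    case False
    let ?K = "inv_into U \<phi> ` cball c r"
    have sub: "cball c r \<subseteq> ball c R" using r by auto
    have "compact ?K"
      using c(4) sub R by (intro compact_continuous_image) (auto simp: homeomorphism_def intro: continuous_on_subset)
    then have "closed ?K" by (rule compact_imp_closed)
    obtain V \<psi> where V: "(V, \<psi>) \<in> A" "q \<in> V" by (rule chart_at)
    let ?W = "V \<inter> - ?K"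
    have oW: "open (\<psi> ` ?W)" by (rule is_chart_open_image[OF chart[OF V(1)]]) (use \<open>closed ?K\<close> in auto)
    have zero: "bump_extend U \<phi> c r u x = 0" if "x \<notin> ?K" for x
    proof (cases "x \<in> U")
      case True
      then have "inv_into U \<phi> (\<phi> x) = x" using c(3) by simp
      then have "\<phi> x \<notin> cball c r" using that by (metis imageI)
      then show ?thesis using bump_outside[OF r(1), of "\<phi> x" c] by (auto simp: bump_extend_def)
    qed (simp add: bump_extend_def)
    have "smooth_on (\<psi> ` ?W) (bump_extend U \<phi> c r u \<circ> inv_into V \<psi>)"
      by (rule smooth_on_cong[OF oW _ smooth_on_const[OF oW, of 0]])
         (use is_chartD(3)[OF chart[OF V(1)]] in \<open>auto simp: zero\<close>)
    moreover have "open ?W" "q \<in> ?W" "?W \<subseteq> V"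
      using is_chartD(1)[OF chart[OF V(1)]] \<open>closed ?K\<close> False sub V(2) by auto
    ultimately show ?thesis using V(1) by blast
  qed
qed

section \<open>Derivations at a point, vector fields and their bracket\<close>

lemma tangent_add: "v \<in> tangent_space A p \<Longrightarrow> f \<in> SF \<Longrightarrow> h \<in> SF \<Longrightarrow> v (\<lambda>x. f x + h x) = v f + v h"
  and tangent_scale: "v \<in> tangent_space A p \<Longrightarrow> f \<in> SF \<Longrightarrow> v (\<lambda>x. c * f x) = c * v f"
  and tangent_mult: "v \<in> tangent_space A p \<Longrightarrow> f \<in> SF \<Longrightarrow> h \<in> SF \<Longrightarrow> v (\<lambda>x. f x * h x) = f p * v h + h p * v f"
  and tangent_nonsmooth: "v \<in> tangent_space A p \<Longrightarrow> f \<notin> SF \<Longrightarrow> v f = 0"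
  unfolding tangent_space_def by blast+

lemma tangent_const:
  assumes "v \<in> tangent_space A p"
  shows "v (\<lambda>_. c) = 0"
proof -
  have "v (\<lambda>_. 1) = 0" using tangent_mult[OF assms SF_const[of 1] SF_const[of 1]] by simp
  then show ?thesis using tangent_scale[OF assms SF_const[of 1], of c] by simp
qed

lemma tangent_sum:
  assumes "v \<in> tangent_space A p" "\<And>i. i \<in> I \<Longrightarrow> f i \<in> SF"
  shows "v (\<lambda>x. \<Sum>i\<in>I. f i x) = (\<Sum>i\<in>I. v (f i))"
  using assms(2)
  by (induction I rule: infinite_finite_induct)
     (auto simp: tangent_const[OF assms(1)] tangent_add[OF assms(1)] SF_sum)

text \<open>Derivations act on globally defined functions only, so Hadamard's expansion of \<open>f\<close> around \<open>p\<close> is first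
  multiplied by the square of a bump function; one factor goes to the coordinates and one to the
  Hadamard coefficients.\<close>

lemma tangent_coordinates:
  assumes U: "(U, \<phi>) \<in> A" "p \<in> U" and v: "v \<in> tangent_space A p"
  obtains w where "\<And>f. f \<in> SF \<Longrightarrow> v f = frechet_derivative (\<lambda>y. f (inv_into U \<phi> y)) (at (\<phi> p)) w"
proof -
  let ?c = "\<phi> p"
  note c = is_chartD[OF chart[OF U(1)]]
  obtain R where R: "R > 0" "ball ?c R \<subseteq> \<phi> ` U" using is_chart_ball[OF chart[OF U(1)] U(2)] .
  define r where "r = R / 2"
  have r: "0 < r" "r < R" using R by (auto simp: r_def)
  define ext where "ext = bump_extend U \<phi> ?c r"
  have ext_SF: "ext u \<in> SF" if "smooth_on (ball ?c R) u" for u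
    unfolding ext_def by (rule bump_extend_smooth[OF U(1) r R(2) that])
  have ext_p: "ext u p = bump ?c r ?c * u ?c" for u
    using U(2) by (simp add: ext_def bump_extend_def)
  define \<eta> where "\<eta> = ext (\<lambda>_. 1)"
  define \<xi> where "\<xi> b = ext (\<lambda>y. (y - ?c) \<bullet> b)" for b
  have \<eta>p: "\<eta> p > 0" using bump_center_pos[OF r(1), of ?c] by (simp add: \<eta>_def ext_p)
  have \<eta>: "\<eta> \<in> SF" unfolding \<eta>_def by (intro ext_SF smooth_on_const open_ball)
  have \<xi>: "\<xi> b \<in> SF" for b
  proof -
    have "smooth_on (ball ?c R) (\<lambda>y. y \<bullet> b + (- (?c \<bullet> b)))"
      by (intro smooth_on_add smooth_on_const smooth_on_bounded_linear bounded_linear_inner_left open_ball)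
    then show ?thesis unfolding \<xi>_def by (intro ext_SF) (simp add: inner_diff_left)
  qed
  \<comment> \<open>\<open>\<xi> b\<close> is \<open>\<eta>\<close> times a coordinate that vanishes
    at \<open>p\<close>, so \<open>v (\<xi> b)\<close> should be \<open>\<eta> p\<close> times the
    component of \<open>v\<close> along \<open>b\<close>; the division recovers that
    component.\<close>
  define w where "w = (\<Sum>b\<in>Basis. (v (\<xi> b) / \<eta> p) *\<^sub>R b)"
  show ?thesis
  proof (rule that)
    fix f assume f: "f \<in> SF"
    let ?F = "\<lambda>y. f (inv_into U \<phi> y)"
    have F: "smooth_on (ball ?c R) ?F" by (rule smooth_on_subset[OF SF_chart[OF f U(1)] R(2)])
    obtain G where G: "\<And>b. smooth_on (ball ?c R) (G b)"
      "\<And>y. y \<in> ball ?c R \<Longrightarrow> ?F y = ?F ?c + (\<Sum>b\<in>Basis. ((y - ?c) \<bullet> b) * G b y)"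
      "\<And>b. G b ?c = frechet_derivative ?F (at ?c) b"
      by (rule hadamard[OF F R(1)]) (rule that)
    \<comment> \<open>After multiplication by the squared cutoff, Hadamard's expansion holds on the
      whole manifold: off the ball of radius \<open>r\<close> all cut-off functions are 0.\<close>
    have eq: "(\<eta> x * \<eta> x) * f x = f p * (\<eta> x * \<eta> x) + (\<Sum>b\<in>Basis. \<xi> b x * ext (G b) x)" for x
    proof (cases "x \<in> U \<and> \<phi> x \<in> ball ?c r")
      case True
      then have "\<phi> x \<in> ball ?c R" using r by auto
      from G(2)[OF this] have "f x = f p + (\<Sum>b\<in>Basis. ((\<phi> x - ?c) \<bullet> b) * G b (\<phi> x))"
        using c(3) U(2) True by simp
      then show ?thesis using True
        by (simp add: \<eta>_def \<xi>_def ext_def bump_extend_def algebra_simps sum_distrib_left)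
    next
      case False
      then have "ext u x = 0" for u
        using bump_outside[OF r(1), of "\<phi> x" ?c] by (auto simp: ext_def bump_extend_def)
      then show ?thesis by (simp add: \<eta>_def \<xi>_def)
    qed
    note sm = SF_mult[OF \<eta> \<eta>] SF_mult[OF \<xi> ext_SF[OF G(1)]]
    have "v (\<lambda>x. (\<eta> x * \<eta> x) * f x) = (\<eta> p * \<eta> p) * v f + f p * v (\<lambda>x. \<eta> x * \<eta> x)"
      by (rule tangent_mult[OF v sm(1) f])
    moreover have "v (\<lambda>x. (\<eta> x * \<eta> x) * f x)
        = v (\<lambda>x. f p * (\<eta> x * \<eta> x) + (\<Sum>b\<in>Basis. \<xi> b x * ext (G b) x))"
      by (simp only: eq)
    moreover have "\<dots> = v (\<lambda>x. f p * (\<eta> x * \<eta> x)) + v (\<lambda>x. \<Sum>b\<in>Basis. \<xi> b x * ext (G b) x)"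
      by (intro tangent_add[OF v] SF_mult SF_const SF_sum \<eta> \<xi> ext_SF G(1))
    moreover have "v (\<lambda>x. f p * (\<eta> x * \<eta> x)) = f p * v (\<lambda>x. \<eta> x * \<eta> x)"
      by (rule tangent_scale[OF v sm(1)])
    moreover have "v (\<lambda>x. \<Sum>b\<in>Basis. \<xi> b x * ext (G b) x) = (\<Sum>b\<in>Basis. v (\<lambda>x. \<xi> b x * ext (G b) x))"
      by (rule tangent_sum[OF v sm(2)])
    moreover have "v (\<lambda>x. \<xi> b x * ext (G b) x) = \<eta> p * (v (\<xi> b) * G b ?c)" for b
    proof -
      have "v (\<lambda>x. \<xi> b x * ext (G b) x) = \<xi> b p * v (ext (G b)) + ext (G b) p * v (\<xi> b)"
        by (rule tangent_mult[OF v \<xi> ext_SF[OF G(1)]])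
      then show ?thesis by (simp add: \<xi>_def \<eta>_def ext_p)
    qed
    \<comment> \<open>The two terms containing \<open>v (\<lambda>x. \<eta> x * \<eta> x)\<close>
      cancel, and since \<open>\<xi> b\<close> vanishes at \<open>p\<close> each product contributes
      a single term.\<close>
    ultimately have "(\<eta> p * \<eta> p) * v f = \<eta> p * (\<Sum>b\<in>Basis. v (\<xi> b) * G b ?c)"
      by (simp add: sum_distrib_left)
    then have "v f = (\<Sum>b\<in>Basis. v (\<xi> b) * G b ?c) / \<eta> p"
      using \<eta>p by (simp add: field_simps)
    also have "\<dots> = (\<Sum>b\<in>Basis. (v (\<xi> b) / \<eta> p) *\<^sub>R frechet_derivative ?F (at ?c) b)"
      by (simp add: G(3) sum_divide_distrib)
    also have "\<dots> = frechet_derivative ?F (at ?c) w"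
    proof -
      have "?c \<in> ball ?c R" using R(1) by simp
      from smooth_on_has_derivative[OF F this]
      interpret bounded_linear "frechet_derivative ?F (at ?c)" by (rule has_derivative_bounded_linear)
      show ?thesis unfolding w_def by (simp only: sum scaleR)
    qed
    finally show "v f = frechet_derivative ?F (at ?c) w" .
  qed
qed

lemma subspace_tangent_space: "subspace (tangent_space A p)"
  unfolding subspace_def tangent_space_def
  by (auto simp: scaleR_fun_def plus_fun_def zero_fun_def algebra_simps)

lemma vector_fieldsD:
  "X \<in> vector_fields A \<Longrightarrow> X p \<in> tangent_space A p"
  "X \<in> vector_fields A \<Longrightarrow> f \<in> SF \<Longrightarrow> (\<lambda>p. X p f) \<in> SF"
  by (auto simp: vector_fields_def)

lemma subspace_vector_fields: "subspace (vector_fields A)"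
  unfolding subspace_def
proof (intro conjI allI ballI)
  show "0 \<in> vector_fields A"
    using subspace_0[OF subspace_tangent_space] by (auto simp: vector_fields_def zero_fun_def SF_const)
next
  fix X Y assume "X \<in> vector_fields A" "Y \<in> vector_fields A"
  then show "X + Y \<in> vector_fields A"
    using subspace_add[OF subspace_tangent_space] by (auto simp: vector_fields_def plus_fun_def intro!: SF_add)
next
  fix c X assume "X \<in> vector_fields A"
  then show "c *\<^sub>R X \<in> vector_fields A"
    using subspace_scale[OF subspace_tangent_space]
    by (auto simp: vector_fields_def scaleR_fun_def intro!: SF_mult SF_const)
qed

text \<open>In the product rule for \<open>X (Y (f h))\<close> the mixed terms
  \<open>X f * Y h + X h * Y f\<close> are symmetric in \<open>X\<close> and \<open>Y\<close> and
  cancel in the commutator. For non-smooth \<open>f\<close> the inner functions are constantly 0,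
  and tangent vectors annihilate constants.\<close>

lemma lie_bracket_vector_field:
  assumes X: "X \<in> vector_fields A" and Y: "Y \<in> vector_fields A"
  shows "lie_bracket X Y \<in> vector_fields A"
proof -
  note S = vector_fieldsD(2)[OF X] vector_fieldsD(2)[OF Y]
  note TX = vector_fieldsD(1)[OF X] and TY = vector_fieldsD(1)[OF Y]
  have "lie_bracket X Y p \<in> tangent_space A p" for p
    unfolding tangent_space_def mem_Collect_eq lie_bracket_def
  proof (intro conjI ballI allI impI)
    fix f h assume f: "f \<in> SF" and h: "h \<in> SF"
    show "X p (\<lambda>q. Y q (\<lambda>x. f x + h x)) - Y p (\<lambda>q. X q (\<lambda>x. f x + h x)) =
          X p (\<lambda>q. Y q f) - Y p (\<lambda>q. X q f) + (X p (\<lambda>q. Y q h) - Y p (\<lambda>q. X q h))"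
      using f h S by (simp add: tangent_add[OF TX] tangent_add[OF TY])
    show "X p (\<lambda>q. Y q (\<lambda>x. f x * h x)) - Y p (\<lambda>q. X q (\<lambda>x. f x * h x)) =
          f p * (X p (\<lambda>q. Y q h) - Y p (\<lambda>q. X q h)) + h p * (X p (\<lambda>q. Y q f) - Y p (\<lambda>q. X q f))"
      using f h S
      by (simp add: tangent_mult[OF TX] tangent_mult[OF TY] tangent_add[OF TX] tangent_add[OF TY] SF_mult algebra_simps)
  next
    fix c f assume f: "f \<in> SF"
    show "X p (\<lambda>q. Y q (\<lambda>x. c * f x)) - Y p (\<lambda>q. X q (\<lambda>x. c * f x)) =
          c * (X p (\<lambda>q. Y q f) - Y p (\<lambda>q. X q f))"
      using f S by (simp add: tangent_scale[OF TX] tangent_scale[OF TY] algebra_simps)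
  next
    fix f assume "f \<notin> SF"
    then show "X p (\<lambda>q. Y q f) - Y p (\<lambda>q. X q f) = 0"
      by (simp add: tangent_nonsmooth[OF TX] tangent_nonsmooth[OF TY] tangent_const[OF TX] tangent_const[OF TY])
  qed
  then show ?thesis
    using S by (auto simp: vector_fields_def lie_bracket_def intro!: SF_diff)
qed

end

section \<open>Traces and conformal endomorphisms\<close>

text \<open>With \<open>d\<close> the \<open>\<beta>\<close>-dual basis of \<open>B\<close>, both \<open>\<Sum>b. \<beta> (T b) (d b)\<close> and \<open>\<Sum>b. \<beta> (T (d b)) b\<close> are the trace
  of \<open>T\<close>, while \<open>\<Sum>b. \<beta> (d b) b\<close> is the dimension.\<close>

lemma conformal_factor_zero:
  fixes V :: "'v::real_vector set" and \<beta> :: "'v \<Rightarrow> 'v \<Rightarrow> real" and T :: "'v \<Rightarrow> 'v"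
  assumes V: "subspace V" "V \<subseteq> span S" "finite S"
    and \<beta>_sym: "\<And>x y. x \<in> V \<Longrightarrow> y \<in> V \<Longrightarrow> \<beta> x y = \<beta> y x"
    and add: "\<And>x y z. x \<in> V \<Longrightarrow> y \<in> V \<Longrightarrow> z \<in> V \<Longrightarrow> \<beta> (x + y) z = \<beta> x z + \<beta> y z"
    and scale: "\<And>c x z. x \<in> V \<Longrightarrow> z \<in> V \<Longrightarrow> \<beta> (c *\<^sub>R x) z = c * \<beta> x z"
    and nondeg: "\<And>x. x \<in> V \<Longrightarrow> (\<And>y. y \<in> V \<Longrightarrow> \<beta> x y = 0) \<Longrightarrow> x = 0"
    and T: "\<And>x. x \<in> V \<Longrightarrow> T x \<in> V"
    and T_add: "\<And>x y. x \<in> V \<Longrightarrow> y \<in> V \<Longrightarrow> T (x + y) = T x + T y"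
    and T_scale: "\<And>c x. x \<in> V \<Longrightarrow> T (c *\<^sub>R x) = c *\<^sub>R T x"
    and trace: "trace_on V T = 0"
    and conformal: "\<And>x y. x \<in> V \<Longrightarrow> y \<in> V \<Longrightarrow> \<beta> (T x) y + \<beta> x (T y) = k * \<beta> x y"
  shows "k = 0 \<or> V = {0}"
proof -
  \<comment> \<open>This is the very choice made inside \<open>trace_on\<close>, so the trace
    hypothesis becomes a statement about this \<open>B\<close>.\<close>
  define B where "B = (SOME B. independent B \<and> span B = V)"
  obtain B0 where "B0 \<subseteq> V" "independent B0" "V \<subseteq> span B0"
    by (rule maximal_independent_subset)
  then have "independent B0 \<and> span B0 = V" using span_minimal[OF _ V(1)] by blast
  then have B: "independent B" "span B = V"
    unfolding B_def by (metis (mono_tags, lifting) someI)+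
  have BV: "b \<in> V" if "b \<in> B" for b using that B(2) span_base by blast
  have fin: "finite B"
    using independent_span_bound[OF V(3) B(1)] V(2) BV by blast
  have sumV: "(\<Sum>i\<in>I. c i *\<^sub>R x i) \<in> V" if "\<And>i. i \<in> I \<Longrightarrow> x i \<in> V" for I :: "'v set" and c x
    using that V(1) by (intro subspace_sum subspace_scale) auto
  have sum_left: "\<beta> (\<Sum>i\<in>I. c i *\<^sub>R x i) z = (\<Sum>i\<in>I. c i * \<beta> (x i) z)"
    if "finite I" "\<And>i. i \<in> I \<Longrightarrow> x i \<in> V" "z \<in> V" for I :: "'v set" and c x z
    using that(1,2)
  proof (induction I)
    case empty
    show ?case using scale[of 0 z 0] that(3) subspace_0[OF V(1)] by simp
  next
    case (insert i I)
    then show ?case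
      using that(3) sumV[of I x c] subspace_scale[OF V(1), of "x i" "c i"] by (simp add: add scale)
  qed
  have T_sum: "T (\<Sum>i\<in>I. c i *\<^sub>R x i) = (\<Sum>i\<in>I. c i *\<^sub>R T (x i))"
    if "finite I" "\<And>i. i \<in> I \<Longrightarrow> x i \<in> V" for I :: "'v set" and c x
    using that
  proof (induction I)
    case empty
    show ?case using T_scale[of 0 0] subspace_0[OF V(1)] by simp
  next
    case (insert i I)
    then show ?case
      using sumV[of I x c] subspace_scale[OF V(1), of "x i" "c i"] by (simp add: T_add T_scale)
  qed
  have expand: "\<exists>c. x = (\<Sum>b\<in>B. c b *\<^sub>R b)" if "x \<in> V" for x
    using that unfolding B(2)[symmetric] span_finite[OF fin] by blast
  have nondeg_B: "x = 0" if "x \<in> V" "\<And>b. b \<in> B \<Longrightarrow> \<beta> x b = 0" for x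
  proof (rule nondeg[OF that(1)])
    fix y assume "y \<in> V"
    then obtain c where "y = (\<Sum>b\<in>B. c b *\<^sub>R b)" using expand by blast
    then have "\<beta> y x = (\<Sum>b\<in>B. c b * \<beta> b x)" using sum_left[OF fin BV that(1)] by simp
    also have "\<dots> = 0" using that BV \<beta>_sym by (intro sum.neutral) auto
    finally show "\<beta> x y = 0" using \<beta>_sym \<open>y \<in> V\<close> that(1) by simp
  qed

  \<comment> \<open>On \<open>V\<close>, \<open>\<Psi>\<close> records the functional
    \<open>\<beta> x\<close> by its values on \<open>B\<close>. Nondegeneracy makes it injective,
    finite dimension makes it onto, and the preimages of the elements of \<open>B\<close> form the
    dual basis.\<close>
  obtain \<Psi> where \<Psi>: "linear \<Psi>" "\<And>a. a \<in> B \<Longrightarrow> \<Psi> a = (\<Sum>b\<in>B. \<beta> a b *\<^sub>R b)"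
    using linear_independent_extend[OF B(1), of "\<lambda>a. \<Sum>b\<in>B. \<beta> a b *\<^sub>R b"] by blast
  have \<Psi>_eq: "\<Psi> x = (\<Sum>b\<in>B. \<beta> x b *\<^sub>R b)" if x: "x \<in> V" for x
  proof -
    obtain c where c: "x = (\<Sum>a\<in>B. c a *\<^sub>R a)" using expand[OF x] by blast
    have "\<Psi> x = (\<Sum>a\<in>B. \<Sum>b\<in>B. (c a * \<beta> a b) *\<^sub>R b)"
      by (simp add: c linear_sum[OF \<Psi>(1)] linear_cmul[OF \<Psi>(1)] \<Psi>(2) scaleR_sum_right)
    also have "\<dots> = (\<Sum>b\<in>B. \<Sum>a\<in>B. (c a * \<beta> a b) *\<^sub>R b)" by (rule sum.swap)
    also have "\<dots> = (\<Sum>b\<in>B. \<beta> x b *\<^sub>R b)"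
      unfolding c using sum_left[OF fin BV BV] by (simp add: scaleR_sum_left)
    finally show ?thesis .
  qed
  have indepD: "u b = 0" if "(\<Sum>b\<in>B. u b *\<^sub>R b) = 0" "b \<in> B" for u b
    using B(1) fin that independentD by blast
  have inj: "inj_on \<Psi> (span B)"
    unfolding linear_injective_on_subspace_0[OF \<Psi>(1) subspace_span]
  proof (intro ballI impI)
    fix x assume x: "x \<in> span B" "\<Psi> x = 0"
    then have xV: "x \<in> V" using B(2) by simp
    show "x = 0" using nondeg_B[OF xV] indepD[of "\<lambda>b. \<beta> x b"] \<Psi>_eq[OF xV] x(2) by simp
  qed
  have ind': "independent (\<Psi> ` B)"
    by (rule linear_independent_injective_image[OF \<Psi>(1) B(1) inj])
  have sub': "\<Psi> ` B \<subseteq> span B"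
    using \<Psi>(2) by (auto intro!: span_sum span_scale intro: span_base)
  have card': "card (\<Psi> ` B) = card B"
    by (rule card_image) (rule inj_on_subset[OF inj span_superset])
  \<comment> \<open>An element of \<open>B\<close> outside the span of the image would give
    \<open>card B + 1\<close> independent vectors in \<open>span B\<close>.\<close>
  have surj: "B \<subseteq> \<Psi> ` V"
  proof
    fix b assume b: "b \<in> B"
    have "b \<in> span (\<Psi> ` B)"
    proof (rule ccontr)
      assume n: "b \<notin> span (\<Psi> ` B)"
      then have "independent (insert b (\<Psi> ` B))" by (intro independent_insertI ind')
      moreover have "insert b (\<Psi> ` B) \<subseteq> span B" using sub' b span_base by blast
      ultimately have "card (insert b (\<Psi> ` B)) \<le> card B"
        using independent_span_bound[OF fin, of "insert b (\<Psi> ` B)"] by simp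
      moreover have "b \<notin> \<Psi> ` B" using n span_base[of b "\<Psi> ` B"] by auto
      ultimately show False using card' fin by simp
    qed
    then show "b \<in> \<Psi> ` V" using linear_span_image[OF \<Psi>(1), of B] B(2) by simp
  qed
  then have "\<forall>b\<in>B. \<exists>d. d \<in> V \<and> \<Psi> d = b" by blast
  then obtain d where d: "\<And>b. b \<in> B \<Longrightarrow> d b \<in> V" "\<And>b. b \<in> B \<Longrightarrow> \<Psi> (d b) = b"
    by metis
  \<comment> \<open>This compares coefficients in \<open>\<Psi> (d b) = b\<close>.\<close>
  have dual: "\<beta> (d b) a = (if a = b then 1 else 0)" if "a \<in> B" "b \<in> B" for a b
  proof -
    have "(\<Sum>a\<in>B. (\<beta> (d b) a - (if a = b then 1 else 0)) *\<^sub>R a)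
        = \<Psi> (d b) - (\<Sum>a\<in>B. (if a = b then 1 else 0) *\<^sub>R a)"
      by (simp add: \<Psi>_eq[OF d(1)[OF that(2)]] scaleR_left_diff_distrib sum_subtractf)
    also have "(\<Sum>a\<in>B. (if a = b then 1 else 0) *\<^sub>R a) = (\<Sum>a\<in>B. if a = b then a else 0)"
      by (rule sum.cong) auto
    also have "\<dots> = b" using fin that(2) by simp
    finally show ?thesis using indepD[OF _ that(1)] d(2)[OF that(2)] by fastforce
  qed

  have "trace_on V T = (\<Sum>b\<in>B. representation B (T b) b)"
    by (simp add: trace_on_def B_def[symmetric] Let_def)
  also have "\<dots> = (\<Sum>b\<in>B. \<beta> (T b) (d b))"
  proof (rule sum.cong)
    fix b assume b: "b \<in> B"
    have "\<beta> (T b) (d b) = \<beta> (\<Sum>a\<in>B. representation B (T b) a *\<^sub>R a) (d b)"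
      using sum_representation_eq[OF B(1) _ fin order_refl, of "T b"] T[OF BV[OF b]] B(2) by simp
    also have "\<dots> = (\<Sum>a\<in>B. representation B (T b) a * \<beta> a (d b))"
      by (rule sum_left[OF fin BV d(1)[OF b]])
    also have "\<dots> = (\<Sum>a\<in>B. if a = b then representation B (T b) a else 0)"
      using b by (intro sum.cong) (auto simp: \<beta>_sym[OF BV d(1)] dual)
    also have "\<dots> = representation B (T b) b" using fin b by simp
    finally show "representation B (T b) b = \<beta> (T b) (d b)" by simp
  qed simp
  finally have tr: "(\<Sum>b\<in>B. \<beta> (T b) (d b)) = 0" using trace by simp

  \<comment> \<open>Pairing with \<open>d a\<close> reads off the coefficient at \<open>a\<close>,
    so the Gram matrix of the dual basis is the matrix of the change of basis.\<close>
  have d_expand: "d b = (\<Sum>a\<in>B. \<beta> (d b) (d a) *\<^sub>R a)" if b: "b \<in> B" for b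
  proof -
    obtain c where c: "d b = (\<Sum>a\<in>B. c a *\<^sub>R a)" using expand[OF d(1)[OF b]] by blast
    have "\<beta> (d b) (d a') = c a'" if a': "a' \<in> B" for a'
    proof -
      have "\<beta> (d b) (d a') = (\<Sum>a\<in>B. c a * \<beta> a (d a'))"
        unfolding c by (rule sum_left[OF fin BV d(1)[OF a']])
      also have "\<dots> = (\<Sum>a\<in>B. if a = a' then c a else 0)"
        using a' by (intro sum.cong) (auto simp: \<beta>_sym[OF BV d(1)] dual)
      also have "\<dots> = c a'" using fin a' by simp
      finally show ?thesis .
    qed
    then show ?thesis by (intro trans[OF c] sum.cong) simp_all
  qed
  \<comment> \<open>Expanding \<open>d b\<close> gives a double sum weighted by the Gram matrix; its
    symmetry allows the sum over \<open>b\<close> to be contracted back to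
    \<open>d a\<close>.\<close>
  have "(\<Sum>b\<in>B. \<beta> (T (d b)) b) = (\<Sum>b\<in>B. \<Sum>a\<in>B. \<beta> (d b) (d a) * \<beta> (T a) b)"
  proof (rule sum.cong)
    fix b assume b: "b \<in> B"
    have "T (\<Sum>a\<in>B. \<beta> (d b) (d a) *\<^sub>R a) = (\<Sum>a\<in>B. \<beta> (d b) (d a) *\<^sub>R T a)"
      by (rule T_sum[OF fin BV])
    then have "T (d b) = (\<Sum>a\<in>B. \<beta> (d b) (d a) *\<^sub>R T a)"
      by (simp only: d_expand[OF b, symmetric])
    then show "\<beta> (T (d b)) b = (\<Sum>a\<in>B. \<beta> (d b) (d a) * \<beta> (T a) b)"
      using sum_left[OF fin T[OF BV] BV[OF b]] by simp
  qed simp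
  also have "\<dots> = (\<Sum>a\<in>B. \<Sum>b\<in>B. \<beta> (d b) (d a) * \<beta> (T a) b)" by (rule sum.swap)
  also have "\<dots> = (\<Sum>a\<in>B. \<beta> (T a) (d a))"
  proof (rule sum.cong)
    fix a assume a: "a \<in> B"
    have "\<beta> (T a) (d a) = \<beta> (d a) (T a)" by (rule \<beta>_sym[OF T[OF BV[OF a]] d(1)[OF a]])
    also have "\<dots> = \<beta> (\<Sum>b\<in>B. \<beta> (d a) (d b) *\<^sub>R b) (T a)"
      by (simp only: d_expand[OF a, symmetric])
    also have "\<dots> = (\<Sum>b\<in>B. \<beta> (d a) (d b) * \<beta> b (T a))"
      by (rule sum_left[OF fin BV T[OF BV[OF a]]])
    also have "\<dots> = (\<Sum>b\<in>B. \<beta> (d b) (d a) * \<beta> (T a) b)"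
      using a by (intro sum.cong refl arg_cong2[of _ _ _ _ "(*)"] \<beta>_sym d BV T)
    finally show "(\<Sum>b\<in>B. \<beta> (d b) (d a) * \<beta> (T a) b) = \<beta> (T a) (d a)" by simp
  qed simp
  finally have tr': "(\<Sum>b\<in>B. \<beta> (T (d b)) b) = 0" using tr by simp

  \<comment> \<open>Summing the conformal identity over the pairs \<open>d b\<close>,
    \<open>b\<close> gives twice the trace on one side and \<open>k * card B\<close> on the
    other.\<close>
  have "0 = (\<Sum>b\<in>B. \<beta> (T (d b)) b + \<beta> (d b) (T b))"
    using tr tr' \<beta>_sym[OF T[OF BV] d(1)] by (simp add: sum.distrib)
  also have "\<dots> = (\<Sum>b\<in>B. k * \<beta> (d b) b)"
    by (intro sum.cong refl conformal d BV)
  also have "\<dots> = k * card B" by (simp add: dual)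
  finally have "k = 0 \<or> B = {}" using fin by simp
  then show ?thesis using B(2) by auto
qed

section \<open>Left-invariant fields on Lie groups\<close>

locale lie_group_manifold =
  fixes A :: "('a::{t2_space,second_countable_topology}, 'e::euclidean_space) chart set"
    and mul :: "'a \<Rightarrow> 'a \<Rightarrow> 'a" and e :: 'a and inve :: "'a \<Rightarrow> 'a"
  assumes lie_group: "lie_group A mul e inve"

sublocale lie_group_manifold \<subseteq> smooth_manifold
  by standard (use lie_group in \<open>simp add: lie_group_def\<close>)

sublocale lie_group_manifold \<subseteq> group mul e inve
  using lie_group by (simp add: lie_group_def)

context lie_group_manifold
begin

text \<open>Smoothness of the multiplication is given through charts of the target, so near each
  point a chart around the product is inserted between \<open>mul\<close> and \<open>f\<close>.
  Translations and invariant fields draw their smoothness from this function of two coordinate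
  variables.\<close>

lemma smooth_mult:
  assumes V: "(V, \<psi>) \<in> A" and U: "(U, \<phi>) \<in> A" and f: "f \<in> SF"
  shows "smooth_on (\<psi> ` V \<times> \<phi> ` U) (\<lambda>z. f (mul (inv_into V \<psi> (fst z)) (inv_into U \<phi> (snd z))))"
proof (rule smooth_on_local)
  let ?m = "\<lambda>z. mul (inv_into V \<psi> (fst z)) (inv_into U \<phi> (snd z))"
  let ?D = "\<psi> ` V \<times> \<phi> ` U"
  note cV = is_chartD[OF chart[OF V]] and cU = is_chartD[OF chart[OF U]]
  have oD: "open ?D" using cV(2) cU(2) by (rule open_Times)
  fix z0 assume z0: "z0 \<in> ?D"
  obtain W \<theta> where W: "(W, \<theta>) \<in> A" "?m z0 \<in> W" by (rule chart_at)
  note cW = is_chartD[OF chart[OF W(1)]]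
  have sm: "smooth_map (product_atlas A A) A (\<lambda>(x, y). mul x y)"
    using lie_group by (simp add: lie_group_def)
  have "continuous_on ?D (\<lambda>z. inv_into V \<psi> (fst z))"
    by (rule continuous_on_compose2[OF homeomorphism_cont2[OF cV(4)] continuous_on_fst[OF continuous_on_id]]) auto
  moreover have "continuous_on ?D (\<lambda>z. inv_into U \<phi> (snd z))"
    by (rule continuous_on_compose2[OF homeomorphism_cont2[OF cU(4)] continuous_on_snd[OF continuous_on_id]]) auto
  ultimately have cont: "continuous_on ?D (\<lambda>z. (inv_into V \<psi> (fst z), inv_into U \<phi> (snd z)))"
    by (rule continuous_on_Pair)
  have "continuous_on UNIV (\<lambda>(x, y). mul x y)"
    using sm by (simp add: smooth_map_def)
  from continuous_on_compose2[OF this cont subset_UNIV]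
  have "continuous_on ?D ?m" by simp
  then have oT: "open (?D \<inter> ?m -` W)"
    by (rule continuous_open_preimage[OF _ oD cW(1)])
  let ?T = "?D \<inter> ?m -` W"
  have "(V \<times> U, map_prod \<psi> \<phi>) \<in> product_atlas A A"
    using V U by (auto simp: product_atlas_def)
  from bspec[OF bspec[OF conjunct2[OF sm[unfolded smooth_map_def]] this, unfolded prod.case] W(1)]
  have smW: "smooth_on (map_prod \<psi> \<phi> ` ((V \<times> U) \<inter> (\<lambda>(x, y). mul x y) -` W))
      (\<theta> \<circ> (\<lambda>(x, y). mul x y) \<circ> inv_into (V \<times> U) (map_prod \<psi> \<phi>))"
    by (simp only: prod.case)
  have inj: "inj_on (map_prod \<psi> \<phi>) (V \<times> U)" using cV(3) cU(3) by (rule map_prod_inj_on)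
  have inv: "inv_into (V \<times> U) (map_prod \<psi> \<phi>) z = (inv_into V \<psi> (fst z), inv_into U \<phi> (snd z))"
    if "z \<in> ?D" for z
    by (rule inv_into_f_eq[OF inj]) (use that in \<open>auto simp: inv_into_into f_inv_into_f\<close>)
  have sub: "?T \<subseteq> map_prod \<psi> \<phi> ` ((V \<times> U) \<inter> (\<lambda>(x, y). mul x y) -` W)"
  proof
    fix z assume z: "z \<in> ?T"
    have "z = map_prod \<psi> \<phi> (inv_into V \<psi> (fst z), inv_into U \<phi> (snd z))"
      using z by (auto simp: f_inv_into_f)
    moreover have "(inv_into V \<psi> (fst z), inv_into U \<phi> (snd z)) \<in> (V \<times> U) \<inter> (\<lambda>(x, y). mul x y) -` W"
      using z by (auto simp: inv_into_into)
    ultimately show "z \<in> map_prod \<psi> \<phi> ` ((V \<times> U) \<inter> (\<lambda>(x, y). mul x y) -` W)"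
      by (rule image_eqI)
  qed
  have smT: "smooth_on ?T (\<lambda>z. \<theta> (?m z))"
    by (rule smooth_on_cong[OF oT _ smooth_on_subset[OF smW sub]]) (simp add: inv)
  have "smooth_on ?T (\<lambda>z. f (inv_into W \<theta> (\<theta> (?m z))))"
    by (rule smooth_on_compose[OF oT cW(2) _ smT SF_chart[OF f W(1)]]) auto
  then have "smooth_on ?T (\<lambda>z. f (?m z))"
    by (rule smooth_on_cong[OF oT, rotated]) (use cW(3) in auto)
  then show "\<exists>T. open T \<and> z0 \<in> T \<and> smooth_on T (\<lambda>z. f (?m z))"
    using oT z0 W(2) by blast
qed

text \<open>The first variable of \<open>smooth_mult\<close> is frozen at the coordinates of
  \<open>a\<close>.\<close>

lemma SF_translate:
  assumes f: "f \<in> SF"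
  shows "(\<lambda>x. f (mul a x)) \<in> SF"
proof (rule SF_I)
  fix U \<phi> assume U: "(U, \<phi>) \<in> A"
  obtain V \<psi> where V: "(V, \<psi>) \<in> A" "a \<in> V" by (rule chart_at)
  note cV = is_chartD[OF chart[OF V(1)]] and cU = is_chartD[OF chart[OF U]]
  have "smooth_on (\<phi> ` U) (\<lambda>y. f (mul (inv_into V \<psi> (fst (\<psi> a, y))) (inv_into U \<phi> (snd (\<psi> a, y)))))"
    by (rule smooth_on_compose[OF cU(2) open_Times[OF cV(2) cU(2)] _
          smooth_on_Pair_right[OF cU(2)] smooth_mult[OF V(1) U f]]) (use V(2) in auto)
  then show "smooth_on (\<phi> ` U) (\<lambda>y. f (mul a (inv_into U \<phi> y)))"
    using V(2) cV(3) by simp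
qed

lemma differential_apply: "f \<in> SF \<Longrightarrow> differential A (mul a) v f = v (\<lambda>x. f (mul a x))"
  by (simp add: differential_def o_def)

lemma differential_tangent:
  assumes v: "v \<in> tangent_space A p"
  shows "differential A (mul a) v \<in> tangent_space A (mul a p)"
  unfolding tangent_space_def mem_Collect_eq
proof (intro conjI ballI allI impI)
  fix f h assume f: "f \<in> SF" and h: "h \<in> SF"
  show "differential A (mul a) v (\<lambda>x. f x + h x) = differential A (mul a) v f + differential A (mul a) v h"
    using f h by (simp add: differential_apply SF_add tangent_add[OF v] SF_translate)
  show "differential A (mul a) v (\<lambda>x. f x * h x)
      = f (mul a p) * differential A (mul a) v h + h (mul a p) * differential A (mul a) v f"
    using f h by (simp add: differential_apply SF_mult tangent_mult[OF v] SF_translate)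
next
  fix c f assume f: "f \<in> SF"
  show "differential A (mul a) v (\<lambda>x. c * f x) = c * differential A (mul a) v f"
    using f by (simp add: differential_apply SF_mult SF_const tangent_scale[OF v] SF_translate)
qed (simp add: differential_def)

section \<open>The Lie algebra and its evaluation at the identity\<close>

abbreviation "LIF \<equiv> left_invariant_fields A mul"

lemma LIF_vector_field: "X \<in> LIF \<Longrightarrow> X \<in> vector_fields A"
  by (simp add: left_invariant_fields_def)

lemma LIF_differential: "X \<in> LIF \<Longrightarrow> differential A (mul a) (X p) = X (mul a p)"
  by (simp add: left_invariant_fields_def)

lemma LIF_translate: "X \<in> LIF \<Longrightarrow> f \<in> SF \<Longrightarrow> X p (\<lambda>x. f (mul a x)) = X (mul a p) f"
  using LIF_differential[of X a p] differential_apply[of f a "X p"] by simp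

lemma LIF_I:
  assumes "X \<in> vector_fields A"
    and "\<And>a p f. f \<in> SF \<Longrightarrow> X p (\<lambda>x. f (mul a x)) = X (mul a p) f"
  shows "X \<in> LIF"
proof -
  have "differential A (mul a) (X p) f = X (mul a p) f" for a p f
    using assms tangent_nonsmooth[OF vector_fieldsD(1)[OF assms(1)]]
    by (cases "f \<in> SF") (simp_all add: differential_def o_def)
  then show ?thesis using assms(1) by (auto simp: left_invariant_fields_def)
qed

lemma subspace_LIF: "subspace LIF"
  unfolding subspace_def
proof (intro conjI allI ballI)
  show "0 \<in> LIF"
    using subspace_0[OF subspace_vector_fields] by (auto intro!: LIF_I simp: zero_fun_def)
next
  fix X Y assume "X \<in> LIF" "Y \<in> LIF"
  then show "X + Y \<in> LIF"
    using subspace_add[OF subspace_vector_fields]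
    by (auto intro!: LIF_I simp: plus_fun_def LIF_vector_field LIF_translate)
next
  fix c X assume "X \<in> LIF"
  then show "c *\<^sub>R X \<in> LIF"
    using subspace_scale[OF subspace_vector_fields]
    by (auto intro!: LIF_I simp: scaleR_fun_def LIF_vector_field LIF_translate)
qed

text \<open>Left invariance says that a field, as an operator on functions, commutes with
  composition by left translations; this passes to commutators.\<close>

lemma lie_bracket_LIF:
  assumes X: "X \<in> LIF" and Y: "Y \<in> LIF"
  shows "lie_bracket X Y \<in> LIF"
proof (rule LIF_I)
  note VX = LIF_vector_field[OF X] and VY = LIF_vector_field[OF Y]
  show "lie_bracket X Y \<in> vector_fields A" using VX VY by (rule lie_bracket_vector_field)
  fix a p f assume f: "f \<in> SF"
  show "lie_bracket X Y p (\<lambda>x. f (mul a x)) = lie_bracket X Y (mul a p) f"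
    using LIF_translate[OF X vector_fieldsD(2)[OF VY f], of p a]
      LIF_translate[OF Y vector_fieldsD(2)[OF VX f], of p a]
    by (simp add: lie_bracket_def LIF_translate[OF X f] LIF_translate[OF Y f])
qed

text \<open>The extension pushes \<open>v\<close> forward by left translations. In charts, its value
  on \<open>f\<close> is the derivative of \<open>f (mul x y)\<close> in the second variable along
  \<open>w\<close> at \<open>e\<close>, that is, a derivative in direction \<open>(0, w)\<close>,
  which depends smoothly on the first variable.\<close>

lemma tangent_extends_to_LIF:
  assumes v: "v \<in> tangent_space A e"
  obtains X where "X \<in> LIF" "X e = v"
proof
  let ?X = "\<lambda>q. differential A (mul q) v"
  obtain U \<phi> where U: "(U, \<phi>) \<in> A" "e \<in> U" by (rule chart_at)
  note cU = is_chartD[OF chart[OF U(1)]]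
  obtain w where w: "\<And>f. f \<in> SF \<Longrightarrow> v f = frechet_derivative (\<lambda>y. f (inv_into U \<phi> y)) (at (\<phi> e)) w"
    using tangent_coordinates[OF U v] by blast
  have "(\<lambda>q. ?X q f) \<in> SF" if f: "f \<in> SF" for f
  proof (rule SF_I)
    fix V \<psi> assume V: "(V, \<psi>) \<in> A"
    note cV = is_chartD[OF chart[OF V]]
    let ?\<Phi> = "\<lambda>z. f (mul (inv_into V \<psi> (fst z)) (inv_into U \<phi> (snd z)))"
    note sm = smooth_mult[OF V U(1) f]
    have "smooth_on (\<psi> ` V) (\<lambda>z. frechet_derivative ?\<Phi> (at (z, \<phi> e)) (0, w))"
      by (rule smooth_on_compose[OF cV(2) open_Times[OF cV(2) cU(2)] _
            smooth_on_Pair_left[OF cV(2)] smooth_on_frechet_derivative[OF sm]]) (use U(2) in auto)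
    then show "smooth_on (\<psi> ` V) (\<lambda>z. ?X (inv_into V \<psi> z) f)"
    proof (rule smooth_on_cong[OF cV(2), rotated])
      fix z assume z: "z \<in> \<psi> ` V"
      have "((\<lambda>y. (z, y)) has_derivative (\<lambda>h. (0, h))) (at (\<phi> e))"
        by (auto intro!: derivative_eq_intros)
      moreover have "(?\<Phi> has_derivative frechet_derivative ?\<Phi> (at (z, \<phi> e))) (at (z, \<phi> e))"
        by (rule smooth_on_has_derivative[OF sm]) (use z U(2) in auto)
      ultimately have "((\<lambda>y. ?\<Phi> (z, y)) has_derivative (\<lambda>h. frechet_derivative ?\<Phi> (at (z, \<phi> e)) (0, h))) (at (\<phi> e))"
        by (rule has_derivative_compose)
      from fun_cong[OF frechet_derivative_at[OF this], of w]
      show "frechet_derivative ?\<Phi> (at (z, \<phi> e)) (0, w) = ?X (inv_into V \<psi> z) f"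
        by (simp add: differential_apply[OF f] w[OF SF_translate[OF f]])
    qed
  qed
  moreover have "?X q \<in> tangent_space A q" for q
    using differential_tangent[OF v, of q] by (simp add: right_neutral)
  ultimately have "?X \<in> vector_fields A" by (simp add: vector_fields_def)
  then show "?X \<in> LIF"
    by (rule LIF_I) (simp add: differential_apply SF_translate assoc)
  show "?X e = v"
    using tangent_nonsmooth[OF v] by (auto simp: differential_def fun_eq_iff o_def)
qed

text \<open>A left-invariant field is determined by its value at \<open>e\<close>, which is a
  directional derivative along some \<open>w\<close>. Thus the fields lie in the range of a linear
  map defined on the model space \<open>'e\<close>.\<close>

lemma LIF_finite_dimensional: "\<exists>S. finite S \<and> LIF \<subseteq> span S"
proof -
  obtain U \<phi> where U: "(U, \<phi>) \<in> A" "e \<in> U" by (rule chart_at)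
  define E where "E w = (\<lambda>q f. if f \<in> SF then
      frechet_derivative (\<lambda>y. f (mul q (inv_into U \<phi> y))) (at (\<phi> e)) w else 0)" for w
  have lin: "linear (frechet_derivative (\<lambda>y. f (mul q (inv_into U \<phi> y))) (at (\<phi> e)))"
    if "f \<in> SF" for f q
    using smooth_on_has_derivative[OF SF_chart[OF SF_translate[OF that] U(1)]] U(2)
    by (blast intro: has_derivative_bounded_linear bounded_linear.linear)
  have "linear E"
    by (rule linearI)
       (auto simp: E_def fun_eq_iff plus_fun_def scaleR_fun_def linear_add[OF lin] linear_cmul[OF lin])
  then have "range E = span (E ` Basis)"
    using linear_span_image[of E Basis] by simp
  moreover have "X \<in> range E" if X: "X \<in> LIF" for X
  proof -
    obtain w where w: "\<And>f. f \<in> SF \<Longrightarrow> X e f = frechet_derivative (\<lambda>y. f (inv_into U \<phi> y)) (at (\<phi> e)) w"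
      using tangent_coordinates[OF U vector_fieldsD(1)[OF LIF_vector_field[OF X]]] by blast
    have "X q f = E w q f" for q f
    proof (cases "f \<in> SF")
      case True
      then show ?thesis
        using LIF_translate[OF X True, of e q] w[OF SF_translate[OF True]] by (simp add: E_def right_neutral)
    next
      case False
      then show ?thesis
        using tangent_nonsmooth[OF vector_fieldsD(1)[OF LIF_vector_field[OF X]]] by (simp add: E_def)
    qed
    then have "X = E w" by (simp add: fun_eq_iff)
    then show ?thesis by blast
  qed
  ultimately show ?thesis by (metis finite_Basis finite_imageI subsetI)
qed

lemma LIF_eq_0:
  assumes X: "X \<in> LIF" "X e = 0"
  shows "X = 0"
proof -
  have "X q f = 0" for q f
  proof (cases "f \<in> SF")
    case True
    show ?thesis using LIF_translate[OF X(1) True, of e q] X(2) by (simp add: right_neutral)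
  next
    case False
    then show ?thesis using tangent_nonsmooth[OF vector_fieldsD(1)[OF LIF_vector_field[OF X(1)]]] by simp
  qed
  then show ?thesis by (simp add: fun_eq_iff)
qed

text \<open>Translation by \<open>inve p\<close> moves \<open>v\<close> to \<open>e\<close>, where
  it extends to an invariant field, which is 0; translation by \<open>p\<close> recovers
  \<open>v\<close>.\<close>

lemma tangent_trivial:
  assumes "LIF = {0}" and v: "v \<in> tangent_space A p"
  shows "v = 0"
proof -
  have "differential A (mul (inve p)) v \<in> tangent_space A e"
    using differential_tangent[OF v, of "inve p"] by simp
  then obtain X where "X \<in> LIF" "X e = differential A (mul (inve p)) v"
    using tangent_extends_to_LIF by blast
  then have z: "differential A (mul (inve p)) v = 0" using assms(1) by simp
  have "v f = 0" for f
  proof (cases "f \<in> SF")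
    case True
    have "v f = differential A (mul (inve p)) v (\<lambda>x. f (mul p x))"
      using True by (simp add: differential_apply SF_translate assoc[symmetric])
    then show ?thesis by (simp add: z)
  qed (rule tangent_nonsmooth[OF v])
  then show ?thesis by (simp add: fun_eq_iff)
qed

end

theorem corollary1:
  fixes A :: "('a::{t2_space,second_countable_topology}, 'e::euclidean_space) chart set"
    and mul :: "'a \<Rightarrow> 'a \<Rightarrow> 'a" and e :: 'a and inve :: "'a \<Rightarrow> 'a"
    and g :: "'a mtensor" and X :: "'a vfield" and lam :: real
  assumes "lie_group A mul e inve"
    and "unimodular A mul"
    and "pseudo_riemannian_metric A g"
    and "left_invariant_metric A mul g"
    and "X \<in> left_invariant_fields A mul"
    and "\<forall>Y\<in>vector_fields A. \<forall>Z\<in>vector_fields A. \<forall>p.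
           (scalar_curvature A g p - lam) * metric_fun g Y Z p
             = 1 / 2 * lie_derivative_metric X g Y Z p"
  shows "killing_field A g X"
proof -
  interpret lie_group_manifold A mul e inve by standard (rule assms(1))
  note metric = assms(3)[unfolded pseudo_riemannian_metric_def]
  have g_sym: "g p u v = g p v u" if "u \<in> tangent_space A p" "v \<in> tangent_space A p" for p u v
    using bspec[OF bspec[OF spec[OF conjunct1[OF metric]]]] that by simp
  have g_add: "g p (u + w) v = g p u v + g p w v"
    if "u \<in> tangent_space A p" "w \<in> tangent_space A p" "v \<in> tangent_space A p" for p u v w
    using metric that by simp
  have g_scale: "g p (c *\<^sub>R u) v = c * g p u v"
    if "u \<in> tangent_space A p" "v \<in> tangent_space A p" for p u v c
    using metric that by simp
  have g_nondeg: "u = 0" if "u \<in> tangent_space A p" "\<And>v. v \<in> tangent_space A p \<Longrightarrow> g p u v = 0" for p u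
    using metric that by simp
  note tan = vector_fieldsD(1)[OF LIF_vector_field]
  have const: "g p (Y p) (Z p) = g e (Y e) (Z e)" if Y: "Y \<in> LIF" and Z: "Z \<in> LIF" for Y Z p
  proof -
    have "g (mul p e) (differential A (mul p) (Y e)) (differential A (mul p) (Z e)) = g e (Y e) (Z e)"
      using assms(4) tan[OF Y, of e] tan[OF Z, of e] unfolding left_invariant_metric_def by blast
    then show ?thesis by (simp add: LIF_differential Y Z)
  qed
  define \<beta> where "\<beta> Y Z = g e (Y e) (Z e)" for Y Z
  have X: "X \<in> LIF" by (rule assms(5))
  have VX: "X \<in> vector_fields A" by (rule LIF_vector_field[OF X])
  \<comment> \<open>At a fixed \<open>p\<close> the factor is a number. Clearing
    \<open>1 / 2\<close> and the minus signs of the bracket terms gives the conformal identity with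
    \<open>k = - 2 * (scalar_curvature A g p - lam)\<close>.\<close>
  have dichotomy: "- 2 * (scalar_curvature A g p - lam) = 0 \<or> LIF = {0}" for p
  proof -
    obtain S where S: "finite S" "LIF \<subseteq> span S" using LIF_finite_dimensional by blast
    show ?thesis
    proof (rule conformal_factor_zero[OF subspace_LIF S(2,1), of \<beta> "lie_bracket X"])
      fix Y Z assume Y: "Y \<in> LIF" and Z: "Z \<in> LIF"
      show "\<beta> Y Z = \<beta> Z Y" unfolding \<beta>_def by (rule g_sym[OF tan[OF Y] tan[OF Z]])
      have "(scalar_curvature A g p - lam) * metric_fun g Y Z p = 1 / 2 * lie_derivative_metric X g Y Z p"
        using assms(6) LIF_vector_field[OF Y] LIF_vector_field[OF Z] by blast
      moreover have metric_YZ: "metric_fun g Y Z = (\<lambda>_. \<beta> Y Z)"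
        unfolding metric_fun_def \<beta>_def by (rule ext) (rule const[OF Y Z])
      \<comment> \<open>The leading term is \<open>X p\<close> applied to a constant function, hence
        0.\<close>
      moreover have "lie_derivative_metric X g Y Z p = - \<beta> (lie_bracket X Y) Z - \<beta> Y (lie_bracket X Z)"
        unfolding lie_derivative_metric_def metric_YZ tangent_const[OF tan[OF X]]
        using const[OF lie_bracket_LIF[OF X Y] Z, of p] const[OF Y lie_bracket_LIF[OF X Z], of p]
        by (simp add: metric_fun_def \<beta>_def)
      ultimately show "\<beta> (lie_bracket X Y) Z + \<beta> Y (lie_bracket X Z)
          = - 2 * (scalar_curvature A g p - lam) * \<beta> Y Z"
        by (simp add: algebra_simps)
    next
      fix Y Y' Z assume "Y \<in> LIF" "Y' \<in> LIF" "Z \<in> LIF"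
      then show "\<beta> (Y + Y') Z = \<beta> Y Z + \<beta> Y' Z"
        unfolding \<beta>_def plus_fun_def[of Y Y'] by (intro g_add tan)
    next
      fix c Y Z assume "Y \<in> LIF" "Z \<in> LIF"
      then show "\<beta> (c *\<^sub>R Y) Z = c * \<beta> Y Z"
        unfolding \<beta>_def scaleR_fun_def[of c Y] by (intro g_scale tan)
    next
      fix Y assume Y: "Y \<in> LIF" and zero: "\<And>Z. Z \<in> LIF \<Longrightarrow> \<beta> Y Z = 0"
      have "g e (Y e) v = 0" if "v \<in> tangent_space A e" for v
        using tangent_extends_to_LIF[OF that] zero unfolding \<beta>_def by metis
      then show "Y = 0" using LIF_eq_0[OF Y] g_nondeg[OF tan[OF Y]] by blast
    next
      fix Y assume "Y \<in> LIF"
      then show "lie_bracket X Y \<in> LIF" by (rule lie_bracket_LIF[OF X])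
    next
      fix Y Y' assume Y: "Y \<in> LIF" and Y': "Y' \<in> LIF"
      show "lie_bracket X (Y + Y') = lie_bracket X Y + lie_bracket X Y'"
      proof (intro ext)
        fix p f
        show "lie_bracket X (Y + Y') p f = (lie_bracket X Y + lie_bracket X Y') p f"
        \<comment> \<open>Tangent vectors are additive on smooth functions only; for other
          \<open>f\<close> every term is a tangent vector applied to the constant 0.\<close>
        proof (cases "f \<in> SF")
          case True
          then show ?thesis
            using vector_fieldsD(2)[OF LIF_vector_field[OF Y]] vector_fieldsD(2)[OF LIF_vector_field[OF Y']]
            by (simp add: lie_bracket_def tangent_add[OF tan[OF X]])
        next
          case False
          then show ?thesis
            by (simp add: lie_bracket_def tangent_nonsmooth[OF tan] X Y Y' tangent_const[OF tan])
        qed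
      qed
    next
      fix c Y assume Y: "Y \<in> LIF"
      show "lie_bracket X (c *\<^sub>R Y) = c *\<^sub>R lie_bracket X Y"
      proof (intro ext)
        fix p f
        show "lie_bracket X (c *\<^sub>R Y) p f = (c *\<^sub>R lie_bracket X Y) p f"
        proof (cases "f \<in> SF")
          case True
          then show ?thesis
            using vector_fieldsD(2)[OF LIF_vector_field[OF Y]]
            by (simp add: lie_bracket_def scaleR_fun_def tangent_scale[OF tan[OF X]] algebra_simps)
        next
          case False
          then show ?thesis
            by (simp add: lie_bracket_def scaleR_fun_def tangent_nonsmooth[OF tan] X Y tangent_const[OF tan])
        qed
      qed
    next
      show "trace_on LIF (lie_bracket X) = 0"
        using assms(2) X by (simp add: unimodular_def)
    qed
  qed
  show ?thesis
    unfolding killing_field_def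
  proof (intro conjI ballI allI VX)
    fix Y Z p assume Y: "Y \<in> vector_fields A" and Z: "Z \<in> vector_fields A"
    have eq: "(scalar_curvature A g p - lam) * metric_fun g Y Z p = 1 / 2 * lie_derivative_metric X g Y Z p"
      using assms(6) Y Z by blast
    from dichotomy[of p] show "lie_derivative_metric X g Y Z p = 0"
    proof
      \<comment> \<open>Here the factor may be nonzero, but \<open>Y p = 0\<close> makes the metric
        side of the equation vanish.\<close>
      assume "LIF = {0}"
      then have "Y p = 0" using tangent_trivial vector_fieldsD(1)[OF Y] by blast
      moreover have "g p (0 *\<^sub>R Y p) (Z p) = 0"
        using g_scale[OF vector_fieldsD(1)[OF Y] vector_fieldsD(1)[OF Z], of p 0] by simp
      ultimately show ?thesis using eq by (simp add: metric_fun_def)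
    qed (use eq in simp)
  qed
qed

end
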